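(* Let $\Omega \subset \mathbf{C}^2$ be a connected Stein neighborhood of the origin, with coordinates $x,y$ on $\mathbf{C}^2$, and put $z := x+y$. Let $D = a_1 D_1 + a_2 D_2 + a_3 D_3$ with $a_1 = a_2 = a_3 = \tfrac23$, where $D_1 = (x=0)$, $D_2 = (y=0)$, $D_3 = (z=0)$, and let $\varphi = \varphi_D = \tfrac23\left(\log|x|^2 + \log|y|^2 + \log|z|^2\right)$ be the associated plurisubharmonic function. Let $\{\varphi_m\}_{m \ge 1}$ be the Demailly approximation sequence of $\varphi$ on $\Omega$. Then $\{\varphi_m\}$ is not decreasing, in the sense that one cannot choose a sequence of constants $C_m$ such that $\varphi_m + C_m$ is a decreasing sequence of $\mathbf{R}\cup\{-\infty\}$-valued functions.
   Context: Demailly approximation sequence of $\varphi$ on $\Omega$: for each integer $m\ge 1$, let $\mathcal{H}_m$ be the Hilbert space of holomorphic functions $f$ on $\Omega$ that are square integrable with respect to the weight $e^{-m\varphi}$, i.e. $\int_\Omega |f|^2 e^{-m\varphi}\, d\lambda < \infty$, where $\lambda$ is Lebesgue measure (here $e^{-m\varphi} = |xyz|^{-4m/3}$), with the corresponding $L^2$ inner product. Let $(\sigma_l)$ be an orthonormal basis of $\mathcal{H}_m$. Then $$\varphi_m := \frac{1}{2m}\log \sum_l |\sigma_l|^2 ,$$ where the sum is the Bergman kernel of $\mathcal{H}_m$ on the diagonal and so does not depend on the choice of orthonormal basis. A sequence of functions $(\psi_m)$ is decreasing if $\psi_{m+1} \le \psi_m$ pointwise for all $m$ (equality allowed).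
   Formalization: Added hypothesis: at least one φ_m (m ≥ 1) is not identically −∞ on Ω, i.e. some H_m ≠ {0}. Without it the claim is false: for Ω = C² every H_m is {0}, so every φ_m ≡ −∞, which is a decreasing sequence. *)

theory Defs
  imports "HOL-Analysis.Analysis"
begin

text \<open>
  Points of $\mathbf{C}^2$ are pairs, so \<open>lborel :: (complex \<times> complex) measure\<close> is Lebesgue
  measure on $\mathbf{C}^2 = \mathbf{R}^4$. Functions on $\Omega$ are total HOL functions of which
  only the values on $\Omega$ matter.
\<close>

text \<open>Complex Fr\'echet differentiability at every point; the differential is required to be
  $\mathbf{C}$-linear, hence of the form $(u,v) \mapsto au + bv$.\<close>

definition holomorphic2_on :: "(complex \<times> complex \<Rightarrow> complex) \<Rightarrow> (complex \<times> complex) set \<Rightarrow> bool" where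
  "holomorphic2_on f \<Omega> \<longleftrightarrow>
     (\<forall>p\<in>\<Omega>. \<exists>a b. (f has_derivative (\<lambda>(u, v). a * u + b * v)) (at p within \<Omega>))"

definition holomorphic_hull :: "(complex \<times> complex) set \<Rightarrow> (complex \<times> complex) set \<Rightarrow> (complex \<times> complex) set" where
  "holomorphic_hull \<Omega> K =
     {p \<in> \<Omega>. \<forall>f. holomorphic2_on f \<Omega> \<longrightarrow> cmod (f p) \<le> (SUP q\<in>K. cmod (f q))}"

text \<open>The two global axioms of a Stein manifold, holomorphic convexity and holomorphic separability
  (the latter is automatic for open subsets of $\mathbf{C}^2$, by the coordinate functions).\<close>

definition stein_open :: "(complex \<times> complex) set \<Rightarrow> bool" where
  "stein_open \<Omega> \<longleftrightarrow> open \<Omega> \<and>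
     (\<forall>K. K \<subseteq> \<Omega> \<and> K \<noteq> {} \<and> compact K \<longrightarrow> compact (holomorphic_hull \<Omega> K)) \<and>
     (\<forall>p\<in>\<Omega>. \<forall>q\<in>\<Omega>. p \<noteq> q \<longrightarrow> (\<exists>f. holomorphic2_on f \<Omega> \<and> f p \<noteq> f q))"

text \<open>Extended logarithm, with $\log 0 = -\infty$.\<close>

definition elog :: "ennreal \<Rightarrow> ereal" where
  "elog t = (if t = 0 then -\<infinity> else if t = \<infinity> then \<infinity> else ereal (ln (enn2real t)))"

text \<open>$e^{-m\varphi}$, with value $+\infty$ where $\varphi = -\infty$.\<close>

definition exp_weight :: "(complex \<times> complex \<Rightarrow> ereal) \<Rightarrow> nat \<Rightarrow> complex \<times> complex \<Rightarrow> ennreal" where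
  "exp_weight \<phi> m p =
     (if \<phi> p = -\<infinity> then \<infinity> else if \<phi> p = \<infinity> then 0
      else ennreal (exp (- real m * real_of_ereal (\<phi> p))))"

text \<open>The measure $e^{-m\varphi}\,d\lambda$ on $\Omega$.\<close>

definition weighted_measure ::
    "(complex \<times> complex) set \<Rightarrow> (complex \<times> complex \<Rightarrow> ereal) \<Rightarrow> nat \<Rightarrow> (complex \<times> complex) measure" where
  "weighted_measure \<Omega> \<phi> m = density (restrict_space lborel \<Omega>) (exp_weight \<phi> m)"

definition bergman_space ::
    "(complex \<times> complex) set \<Rightarrow> (complex \<times> complex \<Rightarrow> ereal) \<Rightarrow> nat \<Rightarrow> (complex \<times> complex \<Rightarrow> complex) set" where
  "bergman_space \<Omega> \<phi> m =
     {f. holomorphic2_on f \<Omega> \<and> integrable (weighted_measure \<Omega> \<phi> m) (\<lambda>p. (cmod (f p))\<^sup>2)}"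

definition bergman_inner ::
    "(complex \<times> complex) set \<Rightarrow> (complex \<times> complex \<Rightarrow> ereal) \<Rightarrow> nat \<Rightarrow>
      (complex \<times> complex \<Rightarrow> complex) \<Rightarrow> (complex \<times> complex \<Rightarrow> complex) \<Rightarrow> complex" where
  "bergman_inner \<Omega> \<phi> m f g = (LINT p|weighted_measure \<Omega> \<phi> m. f p * cnj (g p))"

definition bergman_norm ::
    "(complex \<times> complex) set \<Rightarrow> (complex \<times> complex \<Rightarrow> ereal) \<Rightarrow> nat \<Rightarrow>
      (complex \<times> complex \<Rightarrow> complex) \<Rightarrow> real" where
  "bergman_norm \<Omega> \<phi> m f = sqrt (LINT p|weighted_measure \<Omega> \<phi> m. (cmod (f p))\<^sup>2)"

text \<open>Orthonormal sets with dense linear span; the empty set is the basis of a zero space.\<close>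

definition orthonormal_basis ::
    "(complex \<times> complex) set \<Rightarrow> (complex \<times> complex \<Rightarrow> ereal) \<Rightarrow> nat \<Rightarrow>
      (complex \<times> complex \<Rightarrow> complex) set \<Rightarrow> bool" where
  "orthonormal_basis \<Omega> \<phi> m B \<longleftrightarrow>
     B \<subseteq> bergman_space \<Omega> \<phi> m \<and>
     (\<forall>s\<in>B. \<forall>t\<in>B. bergman_inner \<Omega> \<phi> m s t = (if s = t then 1 else 0)) \<and>
     (\<forall>f\<in>bergman_space \<Omega> \<phi> m. \<forall>\<epsilon>>0. \<exists>F c. finite F \<and> F \<subseteq> B \<and>
        bergman_norm \<Omega> \<phi> m (\<lambda>p. f p - (\<Sum>s\<in>F. c s * s p)) < \<epsilon>)"

definition demailly_approx ::
    "nat \<Rightarrow> (complex \<times> complex \<Rightarrow> complex) set \<Rightarrow> complex \<times> complex \<Rightarrow> ereal" where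
  "demailly_approx m B p =
     ereal (1 / (2 * real m)) * elog (\<Sum>\<^sub>\<infinity>s\<in>B. ennreal ((cmod (s p))\<^sup>2))"

text \<open>\<open>\<psi>\<close> is the sequence of Demailly approximations of $\varphi$ on $\Omega$; the value is
  independent of the orthonormal basis used for each $m$.\<close>

definition demailly_sequence ::
    "(complex \<times> complex) set \<Rightarrow> (complex \<times> complex \<Rightarrow> ereal) \<Rightarrow>
      (nat \<Rightarrow> complex \<times> complex \<Rightarrow> ereal) \<Rightarrow> bool" where
  "demailly_sequence \<Omega> \<phi> \<psi> \<longleftrightarrow>
     (\<forall>m\<ge>1. \<exists>B. orthonormal_basis \<Omega> \<phi> m B \<and> (\<forall>p\<in>\<Omega>. \<psi> m p = demailly_approx m B p))"

text \<open>$\varphi_D$ for $D = a_1 (x=0) + a_2 (y=0) + a_3 (x+y=0)$.\<close>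

definition phi_D :: "real \<Rightarrow> real \<Rightarrow> real \<Rightarrow> complex \<times> complex \<Rightarrow> ereal" where
  "phi_D a1 a2 a3 = (\<lambda>(x, y).
     ereal a1 * elog (ennreal ((cmod x)\<^sup>2)) + ereal a2 * elog (ennreal ((cmod y)\<^sup>2)) +
     ereal a3 * elog (ennreal ((cmod (x + y))\<^sup>2)))"

definition decreasing_sequence_on ::
    "(complex \<times> complex) set \<Rightarrow> (nat \<Rightarrow> complex \<times> complex \<Rightarrow> ereal) \<Rightarrow> bool" where
  "decreasing_sequence_on \<Omega> \<psi> \<longleftrightarrow> (\<forall>m\<ge>1. \<forall>p\<in>\<Omega>. \<psi> (Suc m) p \<le> \<psi> m p)"

end

(* Let H_m be the weighted Bergman space, K_m its kernel on the diagonal, and fix a point (0, y) of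
   the line x = 0 near the origin that lies on neither of the other two lines. Multiplication by
   (xyz)^(2j) maps H_m isometrically into H_(m+3j), so it raises orders of vanishing along x = 0 by
   exactly 2j, and K_(m+3j) vanishes there to order at most 2(2j + N) if some f in H_m vanishes to
   order N.

   Suppose phi_m + C_m is decreasing. Then H_1 is nonzero, because some H_m is. If all elements of
   H_1 vanished at (0, y), then phi_1 would be at most log|x| + O(1) near that point, while
   phi_(1+3j) has order at most (2j + N)/(1 + 3j) -> 2/3 there, a contradiction for large j. So some
   f in H_1 is nonzero at (0, y), and (xyz)^2 f in H_4 gives phi_4 >= (1/2) log|x| - O(1). But
   integrability against |xyz|^(-4) forces every element of H_3 to vanish to order 2 along x = 0, so
   phi_3 <= (2/3) log|x| + O(1), contradicting phi_4 <= phi_3 + O(1). *)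

theory Submission
  imports Defs "HOL-Complex_Analysis.Conformal_Mappings"
begin

text \<open>The obstruction is integer rounding. Near a generic point of the line x = 0, a function
  vanishing there to order a is square integrable against |x|^(-4m/3) exactly when 2a - 4m/3 > -2.
  The least such a is 0, 1, 2, 2 for m = 1, 2, 3, 4, so a/m rises to 2/3 at m = 3 and falls back to
  1/2 at m = 4, whereas a decreasing sequence needs nondecreasing a/m. Additive constants cannot
  repair a change of logarithmic growth.

  Integrability bounds orders only from below. Bounding them from above needs actual elements of
  H_m, and on a possibly unbounded domain even H_1 could be too small. The decrease assumed for
  contradiction supplies them: it carries nonvanishing from some H_m down to H_1, and then to a
  point of the line. If every H_m were zero, all \<phi>_m would be -\<infinity> and trivially
  decreasing; the hypothesis \<open>nonzero\<close> excludes this.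

  The step 3 in m is the least one for which the ratio of the weights is the squared modulus of an
  integral power of xyz.\<close>

subsection \<open>Rotation invariance of Lebesgue measure\<close>

text \<open>On \<open>real^2\<close> multiplication by a unit complex number becomes an orthogonal
  matrix, of determinant 1 or -1. The preimage of a box is the image of a real box under the inverse
  rotation \<open>A\<close>, hence has the same area. Identification and rotation are treated
  together: the case \<open>c = 1\<close> is the identification of the plane with
  \<open>real^2\<close> itself.\<close>

lemma lborel_complex_eq_distr:
  assumes "cmod c = 1"
  shows "lborel = distr (lborel :: (real^2) measure) borel (\<lambda>v. c * Complex (v$1) (v$2))"
proof (rule lborel_eqI)
  define J where "J = (\<lambda>v::real^2. Complex (v$1) (v$2))"
  define V where "V = (\<lambda>z. vector [Re z, Im z] :: real^2)"
  define A where "A = (\<lambda>v. V (cnj c * J v))"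
  have JV: "J (V z) = z" and VJ: "V (J v) = v" for z v
    by (auto simp: J_def V_def vec_eq_iff forall_2)
  have "c * cnj c = 1"
    using assms by (simp add: complex_norm_square[symmetric])
  then have c: "c * (cnj c * w) = w" "cnj c * (c * w) = w" for w
    by (metis mult.assoc mult.commute mult_1)+
  have linA: "linear A"
    by (rule linearI) (auto simp: A_def V_def J_def vec_eq_iff forall_2 algebra_simps)
  have normV: "norm (V z) = cmod z" for z
    by (simp add: V_def norm_vec_def L2_set_def UNIV_2 cmod_def)
  have "norm (A v) = norm v" for v
    using assms normV[of "cnj c * J v"] normV[of "J v"] by (simp add: A_def VJ norm_mult)
  then have "orthogonal_transformation A"
    using linA by (simp add: orthogonal_transformation)
  then have "\<bar>det (matrix A)\<bar> = 1"
    using det_orthogonal_matrix orthogonal_transformation_matrix by fastforce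
  then have meas: "emeasure lebesgue (A ` S) = emeasure lebesgue S" if "S \<in> lmeasurable" for S
    using measurable_linear_image[OF linA that] measure_linear_image[OF linA that] that
    by (simp add: emeasure_eq_measure2)
  have cont: "continuous_on UNIV (\<lambda>v::real^2. c * Complex (v$1) (v$2))"
    unfolding complex_eq_iff Complex_eq by (intro continuous_intros)
  fix l u :: complex assume lu: "\<And>b. b \<in> Basis \<Longrightarrow> l \<bullet> b \<le> u \<bullet> b"
  have le: "Re l \<le> Re u" "Im l \<le> Im u"
    using lu[of 1] lu[of \<i>] by (auto simp: Basis_complex_def)
  have pre: "(\<lambda>v. c * J v) -` box l u = A ` box (V l) (V u)"
  proof (intro set_eqI iffI)
    fix v assume "v \<in> (\<lambda>v. c * J v) -` box l u"
    then have "V (c * J v) \<in> box (V l) (V u)"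
      by (auto simp: mem_box_cart forall_2 V_def in_box_complex_iff)
    moreover have "A (V (c * J v)) = v"
      by (simp add: A_def JV VJ c)
    ultimately show "v \<in> A ` box (V l) (V u)" by (metis imageI)
  next
    fix v assume "v \<in> A ` box (V l) (V u)"
    then obtain w where w: "w \<in> box (V l) (V u)" "v = A w" by auto
    then have "c * J v = J w"
      by (simp add: A_def JV c)
    with w show "v \<in> (\<lambda>v. c * J v) -` box l u"
      by (auto simp: mem_box_cart forall_2 V_def J_def in_box_complex_iff)
  qed
  have m: "(\<lambda>v. c * J v) \<in> borel_measurable lborel"
    using cont by (simp add: J_def borel_measurable_continuous_onI)
  have "emeasure (distr lborel borel (\<lambda>v. c * J v)) (box l u) = emeasure lborel (A ` box (V l) (V u))"
    using m by (subst emeasure_distr) (auto simp: pre)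
  also have "\<dots> = emeasure lebesgue (A ` box (V l) (V u))"
    using measurable_sets[OF m, of "box l u"] by (simp add: pre)
  also have "\<dots> = emeasure lborel (box (V l) (V u))"
    using meas[of "box (V l) (V u)"] by simp
  also have "\<dots> = ennreal (measure lborel (cbox (V l) (V u)))"
    by (subst emeasure_eq_ennreal_measure[symmetric]) (auto simp: emeasure_lborel_box_eq emeasure_lborel_cbox_eq)
  also have "measure lborel (cbox (V l) (V u)) = (Re u - Re l) * (Im u - Im l)"
    using le by (subst content_cbox_cart) (auto simp: forall_2 V_def UNIV_2 interval_ne_empty_cart)
  finally show "emeasure (distr lborel borel (\<lambda>v::real^2. c * Complex (v$1) (v$2))) (box l u)
      = ennreal (\<Prod>b\<in>Basis. (u - l) \<bullet> b)"
    by (simp add: J_def Basis_complex_def)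
qed simp

lemma lborel_distr_mult_complex:
  assumes "cmod c = 1"
  shows "distr lborel borel ((*) c) = (lborel :: complex measure)"
proof -
  have "distr lborel borel ((*) c)
      = distr (distr (lborel :: (real^2) measure) borel (\<lambda>v. Complex (v$1) (v$2))) borel ((*) c)"
    using lborel_complex_eq_distr[of 1] by simp
  also have "\<dots> = distr (lborel :: (real^2) measure) borel (\<lambda>v. c * Complex (v$1) (v$2))"
  proof (subst distr_distr)
    have "continuous_on UNIV (\<lambda>v::real^2. Complex (v$1) (v$2))"
      unfolding complex_eq_iff Complex_eq by (intro continuous_intros)
    then show "(\<lambda>v::real^2. Complex (v$1) (v$2)) \<in> lborel \<rightarrow>\<^sub>M borel"
      by (simp add: borel_measurable_continuous_onI)
  qed (auto simp: comp_def)
  finally show ?thesis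
    using lborel_complex_eq_distr[OF assms] by simp
qed

lemma lborel_distr_mult_complex2:
  assumes "cmod c = 1"
  shows "distr lborel borel (\<lambda>(u, v). (c * u, c * v)) = (lborel :: (complex \<times> complex) measure)"
proof -
  have "sigma_finite_measure (distr lborel borel ((*) c))"
    using lborel_distr_mult_complex[OF assms] sigma_finite_lborel by metis
  then have "distr lborel borel ((*) c) \<Otimes>\<^sub>M distr lborel borel ((*) c)
      = distr (lborel \<Otimes>\<^sub>M lborel) (borel \<Otimes>\<^sub>M borel) (\<lambda>(u, v). (c * u, c * v))"
    by (intro pair_measure_distr) auto
  then show ?thesis
    by (simp add: lborel_distr_mult_complex[OF assms] lborel_prod borel_prod)
qed

subsection \<open>Holomorphic functions of two variables\<close>

text \<open>Cauchy's formula on the unit circle. The right side is a nonnegative extended integral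
  so that it can later be exchanged with an integral over a polydisc without any integrability
  condition.\<close>

lemma circle_mean_value_le:
  assumes "h holomorphic_on S" "open S" "cball 0 1 \<subseteq> S"
  shows "ennreal (cmod (h 0)) \<le> (\<integral>\<^sup>+t\<in>{0..1}. ennreal (cmod (h (exp (2 * of_real pi * \<i> * of_real t)))) \<partial>lborel)"
proof -
  let ?e = "\<lambda>t::real. exp (2 * of_real pi * \<i> * of_real t)"
  have "((\<lambda>u. h u / (u - 0)) has_contour_integral (2 * of_real pi * \<i> * h 0)) (circlepath 0 1)"
    using assms by (intro Cauchy_integral_circlepath_simple) (auto intro: holomorphic_on_subset)
  then have "((\<lambda>t. h (circlepath 0 1 t) / circlepath 0 1 t * vector_derivative (circlepath 0 1) (at t))
      has_integral (2 * of_real pi * \<i> * h 0)) {0..1}"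
    by (simp add: has_contour_integral)
  then have "((\<lambda>t. (2 * of_real pi * \<i>) * h (?e t)) has_integral ((2 * of_real pi * \<i>) * h 0)) {0..1}"
    unfolding vector_derivative_circlepath by (simp add: circlepath mult_ac)
  then have int: "((\<lambda>t. h (?e t)) has_integral h 0) {0..1}"
    by (subst (asm) has_integral_mult_right_iff) auto
  have e: "range ?e \<subseteq> S"
    using assms(3) by (auto simp: norm_exp_eq_Re)
  have "continuous_on UNIV ?e"
    by (intro continuous_intros)
  then have cont: "continuous_on UNIV (\<lambda>t. h (?e t))"
    using e holomorphic_on_imp_continuous_on[OF assms(1)] by (rule continuous_on_compose2[rotated])
  then have cont01: "continuous_on {0..1} (\<lambda>t. h (?e t))"
    by (rule continuous_on_subset) simp
  have "cmod (h 0) = cmod (integral {0..1} (\<lambda>t. h (?e t)))"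
    using int by (simp add: integral_unique)
  also have "\<dots> \<le> integral {0..1} (\<lambda>t. cmod (h (?e t)))"
    by (intro integral_norm_bound_integral integrable_continuous_interval continuous_on_norm cont01) simp
  finally have "ennreal (cmod (h 0)) \<le> ennreal (integral {0..1} (\<lambda>t. cmod (h (?e t))))"
    by (rule ennreal_leI)
  also have "\<dots> = (\<integral>\<^sup>+t\<in>{0..1}. ennreal (cmod (h (?e t))) \<partial>lborel)"
    by (intro nn_integral_has_integral_lebesgue'[symmetric] integrable_integral
        integrable_continuous_interval continuous_on_norm cont01) simp
  finally show ?thesis .
qed

section \<open>Closure properties of holomorphy and restriction to complex lines\<close>

lemma holomorphic2_on_subset:
  "holomorphic2_on f \<Omega> \<Longrightarrow> S \<subseteq> \<Omega> \<Longrightarrow> holomorphic2_on f S"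
  unfolding holomorphic2_on_def by (meson has_derivative_subset subsetD)

lemma holomorphic2_imp_continuous_on:
  "holomorphic2_on f \<Omega> \<Longrightarrow> continuous_on \<Omega> f"
  unfolding holomorphic2_on_def
  by (meson continuous_on_eq_continuous_within has_derivative_continuous)

lemma holomorphic2_on_mult:
  assumes "holomorphic2_on f \<Omega>" "holomorphic2_on g \<Omega>"
  shows "holomorphic2_on (\<lambda>p. f p * g p) \<Omega>"
  unfolding holomorphic2_on_def
proof
  fix p assume "p \<in> \<Omega>"
  then obtain a b c d where
    "(f has_derivative (\<lambda>(u, v). a * u + b * v)) (at p within \<Omega>)"
    "(g has_derivative (\<lambda>(u, v). c * u + d * v)) (at p within \<Omega>)"
    using assms unfolding holomorphic2_on_def by meson
  then have "((\<lambda>p. f p * g p) has_derivative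
      (\<lambda>h. f p * (case h of (u, v) \<Rightarrow> c * u + d * v) + (case h of (u, v) \<Rightarrow> a * u + b * v) * g p)) (at p within \<Omega>)"
    by (rule has_derivative_mult)
  moreover have "(\<lambda>h. f p * (case h of (u, v) \<Rightarrow> c * u + d * v) + (case h of (u, v) \<Rightarrow> a * u + b * v) * g p)
      = (\<lambda>(u, v). (f p * c + a * g p) * u + (f p * d + b * g p) * v)"
    by (auto simp: algebra_simps)
  ultimately show "\<exists>a b. ((\<lambda>p. f p * g p) has_derivative (\<lambda>(u, v). a * u + b * v)) (at p within \<Omega>)"
    by auto
qed

lemma holomorphic2_on_linear: "holomorphic2_on (\<lambda>p. a * fst p + b * snd p) \<Omega>"
  unfolding holomorphic2_on_def case_prod_unfold
  by (intro ballI exI[of _ a] exI[of _ b]) (auto intro!: derivative_eq_intros)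

lemma holomorphic2_on_const: "holomorphic2_on (\<lambda>p. c) \<Omega>"
  unfolding holomorphic2_on_def case_prod_unfold
  by (intro ballI exI[of _ 0]) simp

lemma holomorphic2_on_diff:
  assumes "holomorphic2_on f \<Omega>" "holomorphic2_on g \<Omega>"
  shows "holomorphic2_on (\<lambda>p. f p - g p) \<Omega>"
  unfolding holomorphic2_on_def
proof
  fix p assume "p \<in> \<Omega>"
  then obtain a b c d where
    "(f has_derivative (\<lambda>(u, v). a * u + b * v)) (at p within \<Omega>)"
    "(g has_derivative (\<lambda>(u, v). c * u + d * v)) (at p within \<Omega>)"
    using assms unfolding holomorphic2_on_def by meson
  then have "((\<lambda>p. f p - g p) has_derivative
      (\<lambda>h. (case h of (u, v) \<Rightarrow> a * u + b * v) - (case h of (u, v) \<Rightarrow> c * u + d * v))) (at p within \<Omega>)"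
    by (rule has_derivative_diff)
  moreover have "(\<lambda>h. (case h of (u, v) \<Rightarrow> a * u + b * v) - (case h of (u, v) \<Rightarrow> c * u + d * v))
      = (\<lambda>(u, v). (a - c) * u + (b - d) * v)"
    by (auto simp: algebra_simps)
  ultimately show "\<exists>a b. ((\<lambda>p. f p - g p) has_derivative (\<lambda>(u, v). a * u + b * v)) (at p within \<Omega>)"
    by auto
qed

lemma holomorphic2_on_sum:
  assumes "finite F" "\<And>s. s \<in> F \<Longrightarrow> holomorphic2_on (g s) \<Omega>"
  shows "holomorphic2_on (\<lambda>p. \<Sum>s\<in>F. g s p) \<Omega>"
  using assms
proof (induction F rule: finite_induct)
  case empty
  then show ?case using holomorphic2_on_const[of 0] by simp
next
  case (insert x F)
  then have "holomorphic2_on (\<lambda>p. g x p - (0 - (\<Sum>s\<in>F. g s p))) \<Omega>"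
    by (intro holomorphic2_on_diff holomorphic2_on_const) auto
  with insert show ?case by simp
qed

text \<open>The bridge to one variable: the mean value inequality, the identity theorem and the
  orders of vanishing along x = 0 are all derived by restricting to complex lines.\<close>

lemma holomorphic2_on_line:
  assumes "holomorphic2_on f \<Omega>" "open \<Omega>"
  shows "(\<lambda>t. f (x + t * u, y + t * v)) holomorphic_on {t. (x + t * u, y + t * v) \<in> \<Omega>}"
proof (rule holomorphic_onI)
  fix t assume t: "t \<in> {t. (x + t * u, y + t * v) \<in> \<Omega>}"
  let ?l = "\<lambda>t. (x + t * u, y + t * v)"
  have lt: "?l t \<in> \<Omega>" using t by blast
  from bspec[OF assms(1)[unfolded holomorphic2_on_def] this]
  obtain a b where "(f has_derivative (\<lambda>(u, v). a * u + b * v)) (at (?l t) within \<Omega>)"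
    by (elim exE) (rule that)
  then have f: "(f has_derivative (\<lambda>(u, v). a * u + b * v)) (at (?l t))"
    unfolding at_within_open[OF lt assms(2)] .
  have "(?l has_derivative (\<lambda>h. (h * u, h * v))) (at t)"
    by (rule has_derivative_Pair) (auto intro!: derivative_eq_intros)
  from has_derivative_compose[OF this f]
  have "((\<lambda>t. f (?l t)) has_derivative (\<lambda>h. a * (h * u) + b * (h * v))) (at t)"
    by simp
  moreover have "(\<lambda>h. a * (h * u) + b * (h * v)) = (*) (a * u + b * v)"
    by (rule ext) algebra
  ultimately have "((\<lambda>t. f (?l t)) has_field_derivative (a * u + b * v)) (at t)"
    by (simp only: has_field_derivative_def)
  then show "(\<lambda>t. f (?l t)) field_differentiable at t within {t. ?l t \<in> \<Omega>}"
    unfolding field_differentiable_def using has_field_derivative_at_within by blast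
qed

lemma open_line_vimage:
  fixes \<Omega> :: "(complex \<times> complex) set"
  assumes "open \<Omega>"
  shows "open {t. (x + t * u, y + t * v) \<in> \<Omega>}"
proof -
  have "open ((\<lambda>t. (x + t * u, y + t * v)) -` \<Omega>)"
    using assms by (intro open_vimage continuous_intros)
  then show ?thesis by (simp add: vimage_def)
qed

text \<open>Averaging over the circle action $w \mapsto e^{i\theta} w$, which preserves Lebesgue measure and
  every polydisc centred at the origin, reduces the mean value inequality to one variable.\<close>

lemma holomorphic2_mean_value_le:
  assumes f: "holomorphic2_on f \<Omega>" and \<Omega>: "open \<Omega>"
    and sub: "ball x r \<times> ball y s \<subseteq> \<Omega>"
  shows "ennreal ((cmod (f (x, y)))\<^sup>2) * emeasure lborel (ball (0::complex) r \<times> ball (0::complex) s)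
     \<le> (\<integral>\<^sup>+q\<in>ball x r \<times> ball y s. ennreal ((cmod (f q))\<^sup>2) \<partial>lborel)"
proof -
  define P where "P = ball (0::complex) r \<times> ball (0::complex) s"
  define G where "G = (\<lambda>q. ennreal ((cmod (f q))\<^sup>2) * indicator (ball x r \<times> ball y s) q)"
  define e where "e = (\<lambda>t::real. exp (2 * of_real pi * \<i> * of_real t))"
  define R where "R = (\<lambda>t w. (x, y) + (case w of (u, v) \<Rightarrow> (e t * u, e t * v)))"
  have e1: "cmod (e t) = 1" for t
    by (simp add: e_def norm_exp_eq_Re)
  have opP: "open (ball x r \<times> ball y s)" by (intro open_Times) auto
  have "continuous_on (ball x r \<times> ball y s) f"
    using f sub holomorphic2_imp_continuous_on continuous_on_subset by blast
  then have "(\<lambda>q. indicator (ball x r \<times> ball y s) q *\<^sub>R f q) \<in> borel_measurable borel"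
    using opP by (intro borel_measurable_continuous_on_indicator) auto
  then have "(\<lambda>q. ennreal ((cmod (indicator (ball x r \<times> ball y s) q *\<^sub>R f q))\<^sup>2)) \<in> borel_measurable borel"
    by measurable
  also have "(\<lambda>q. ennreal ((cmod (indicator (ball x r \<times> ball y s) q *\<^sub>R f q))\<^sup>2)) = G"
    by (auto simp: G_def indicator_def)
  finally have G[measurable]: "G \<in> borel_measurable borel" .
  have RP: "indicator (ball x r \<times> ball y s) (R t w) = (indicator P w :: ennreal)" for t w
    by (cases w) (simp add: R_def P_def indicator_def dist_norm norm_mult e1)
  have inv: "(\<integral>\<^sup>+w. G (R t w) \<partial>lborel) = (\<integral>\<^sup>+q. G q \<partial>lborel)" for t
  proof -
    have c: "(\<lambda>(u, v). (e t * u, e t * v)) \<in> borel_measurable borel"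
      unfolding case_prod_unfold by (intro borel_measurable_continuous_onI continuous_intros)
    have "(\<integral>\<^sup>+q. G q \<partial>lborel) = (\<integral>\<^sup>+q. G q \<partial>distr lborel borel ((+) (x, y)))"
      by (simp add: lborel_distr_plus)
    also have "\<dots> = (\<integral>\<^sup>+w. G ((x, y) + w) \<partial>lborel)"
      by (subst nn_integral_distr) auto
    also have "\<dots> = (\<integral>\<^sup>+w. G ((x, y) + w) \<partial>distr lborel borel (\<lambda>(u, v). (e t * u, e t * v)))"
      using lborel_distr_mult_complex2[OF e1] by simp
    also have "\<dots> = (\<integral>\<^sup>+w. G (R t w) \<partial>lborel)"
      using c by (subst nn_integral_distr) (auto simp: R_def)
    finally show ?thesis by simp
  qed
  have point: "ennreal ((cmod (f (x, y)))\<^sup>2) * indicator P w \<le> (\<integral>\<^sup>+t. G (R t w) * indicator {0..1} t \<partial>lborel)" for w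
  proof (cases "w \<in> P")
    case True
    obtain u v where w: "w = (u, v)" by (cases w)
    let ?S = "{t. (x + t * u, y + t * v) \<in> \<Omega>}"
    have "cball 0 1 \<subseteq> ?S"
    proof
      fix t :: complex assume "t \<in> cball 0 1"
      then have "cmod (t * z) \<le> cmod z" for z
        by (simp add: norm_mult mult_left_le_one_le)
      then have "(x + t * u, y + t * v) \<in> ball x r \<times> ball y s"
        using True order_le_less_trans by (fastforce simp: w P_def dist_norm)
      then show "t \<in> ?S" using sub by blast
    qed
    \<comment> \<open>Since f^2 is itself holomorphic along the line, the inequality for the modulus
      of a holomorphic function already gives the one for |f|^2.\<close>
    moreover have "(\<lambda>t. (f (x + t * u, y + t * v))\<^sup>2) holomorphic_on ?S"
      using holomorphic2_on_line[OF f \<Omega>] by (rule holomorphic_on_power)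
    ultimately have "ennreal (cmod ((f (x + 0 * u, y + 0 * v))\<^sup>2))
        \<le> (\<integral>\<^sup>+t\<in>{0..1}. ennreal (cmod ((f (x + e t * u, y + e t * v))\<^sup>2)) \<partial>lborel)"
      unfolding e_def using open_line_vimage[OF \<Omega>] by (intro circle_mean_value_le)
    also have "\<dots> = (\<integral>\<^sup>+t. G (R t w) * indicator {0..1} t \<partial>lborel)"
      using True RP[of _ w] by (simp add: G_def R_def w norm_power)
    finally show ?thesis using True by (simp add: norm_power)
  qed simp
  have meas: "(\<lambda>(w, t). G (R t w) * indicator {0..1} t) \<in> borel_measurable (lborel \<Otimes>\<^sub>M lborel)"
  proof -
    have "(\<lambda>z. R (snd z) (fst z)) \<in> borel_measurable borel"
      unfolding R_def e_def case_prod_unfold by (intro borel_measurable_continuous_onI continuous_intros)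
    then have [measurable]: "(\<lambda>z. R (snd z) (fst z)) \<in> borel_measurable (borel \<Otimes>\<^sub>M borel)"
      by (simp add: borel_prod)
    have "(\<lambda>z. G (R (snd z) (fst z)) * indicator {0..1} (snd z)) \<in> borel_measurable (borel \<Otimes>\<^sub>M borel)"
      by measurable
    then show ?thesis by (simp add: case_prod_unfold cong: measurable_cong_sets)
  qed
  have "ennreal ((cmod (f (x, y)))\<^sup>2) * emeasure lborel P = (\<integral>\<^sup>+w. ennreal ((cmod (f (x, y)))\<^sup>2) * indicator P w \<partial>lborel)"
    by (subst nn_integral_cmult_indicator) (auto simp: P_def intro!: borel_open open_Times)
  also have "\<dots> \<le> (\<integral>\<^sup>+w. (\<integral>\<^sup>+t. G (R t w) * indicator {0..1} t \<partial>lborel) \<partial>lborel)"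
    by (intro nn_integral_mono point)
  \<comment> \<open>After the exchange, the inner integral for fixed t no longer depends on t,
    because the rotation by \<open>e t\<close> preserves both the measure and the polydisc. The
    t-integral then only contributes the length of {0..1}.\<close>
  also have "\<dots> = (\<integral>\<^sup>+t. (\<integral>\<^sup>+w. G (R t w) * indicator {0..1} t \<partial>lborel) \<partial>lborel)"
    using meas by (intro lborel_pair.Fubini'[symmetric])
  also have "\<dots> = (\<integral>\<^sup>+t. (\<integral>\<^sup>+q. G q \<partial>lborel) * indicator {0..1} (t::real) \<partial>lborel)"
  proof (intro nn_integral_cong)
    fix t :: real
    show "(\<integral>\<^sup>+w. G (R t w) * indicator {0..1} t \<partial>lborel) = (\<integral>\<^sup>+q. G q \<partial>lborel) * indicator {0..1} t"
      by (cases "t \<in> {0..1}") (auto simp: inv)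
  qed
  also have "\<dots> = (\<integral>\<^sup>+q. G q \<partial>lborel)"
    by (subst nn_integral_cmult_indicator) auto
  finally show ?thesis by (simp add: P_def G_def)
qed

lemma emeasure_lborel_polydisc:
  assumes "0 \<le> r" "0 \<le> s"
  shows "emeasure lborel (ball (x::complex) r \<times> ball (y::complex) s) = ennreal (pi\<^sup>2 * r\<^sup>2 * s\<^sup>2)"
proof -
  have b: "emeasure lborel (ball z t) = ennreal (pi * t\<^sup>2)" if "0 \<le> t" for z :: complex and t
    using that by (simp add: emeasure_ball unit_ball_vol_2)
  have "emeasure (lborel \<Otimes>\<^sub>M lborel) (ball x r \<times> ball y s) = emeasure lborel (ball x r) * emeasure lborel (ball y s)"
    by (intro lborel.emeasure_pair_measure_Times) auto
  also have "\<dots> = ennreal (pi * r\<^sup>2 * (pi * s\<^sup>2))"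
    using assms by (simp add: b ennreal_mult)
  also have "pi * r\<^sup>2 * (pi * s\<^sup>2) = pi\<^sup>2 * r\<^sup>2 * s\<^sup>2"
    by (simp add: power2_eq_square)
  finally show ?thesis by (simp add: lborel_prod)
qed

text \<open>The interior Z of the zero set is open by construction. It is also relatively closed: if
  a ball in \<Omega> meets Z in b, then any c in the ball is joined to b by a complex line whose
  trace on the ball is convex, and one-variable continuation along it carries the zeros near b to c.
  Connectedness of \<Omega> concludes.\<close>

lemma holomorphic2_identity:
  assumes f: "holomorphic2_on f \<Omega>" and \<Omega>: "open \<Omega>" "connected \<Omega>"
    and p: "p \<in> \<Omega>" and z: "\<forall>\<^sub>F q in nhds p. f q = 0" and q: "q \<in> \<Omega>"
  shows "f q = 0"
proof -
  define Z where "Z = {p. \<forall>\<^sub>F q in nhds p. f q = 0}"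
  have "open Z"
    unfolding Z_def open_subopen[of "Collect _"]
    by (metis (mono_tags, lifting) eventually_eventually eventually_nhds mem_Collect_eq subsetI)
  moreover have "open (\<Omega> - Z)"
  proof (rule Topological_Spaces.openI)
    fix a assume a: "a \<in> \<Omega> - Z"
    then obtain r where r: "r > 0" "ball a r \<subseteq> \<Omega>"
      using \<Omega>(1) openE by blast
    have "ball a r \<inter> Z = {}"
    proof (rule ccontr)
      assume "ball a r \<inter> Z \<noteq> {}"
      then obtain b where b: "b \<in> ball a r" "b \<in> Z" by blast
      have "f c = 0" if c: "c \<in> ball a r" for c
      proof -
        obtain x y where xy: "b = (x, y)" by (cases b)
        obtain u v where uv: "c = (x + u, y + v)"
          by (cases c) (metis add_diff_cancel_left' diff_add_cancel add.commute)
        let ?l = "\<lambda>t. (x + t * u, y + t * v)"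
        let ?T = "{t. ?l t \<in> ball a r}"
        have hol: "(\<lambda>t. f (?l t)) holomorphic_on ?T"
          using holomorphic2_on_line[OF holomorphic2_on_subset[OF f r(2)]] by blast
        have "convex ?T"
        proof (rule convexI)
          fix s t :: complex and \<alpha> \<beta> :: real
          assume *: "s \<in> ?T" "t \<in> ?T" "0 \<le> \<alpha>" "0 \<le> \<beta>" "\<alpha> + \<beta> = 1"
          then have "\<alpha> *\<^sub>R ?l s + \<beta> *\<^sub>R ?l t \<in> ball a r"
            by (intro convexD[OF convex_ball]) auto
          moreover have "\<alpha> *\<^sub>R z + \<beta> *\<^sub>R z = z" for z :: complex
            using *(5) by (metis scaleR_left_distrib scaleR_one)
          then have "\<alpha> *\<^sub>R ?l s + \<beta> *\<^sub>R ?l t = ?l (\<alpha> *\<^sub>R s + \<beta> *\<^sub>R t)"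
            by (auto simp: algebra_simps)
          ultimately show "\<alpha> *\<^sub>R s + \<beta> *\<^sub>R t \<in> ?T" by simp
        qed
        then have conn: "connected ?T" by (rule convex_connected)
        have opT: "open ?T" by (rule open_line_vimage) simp
        have "\<forall>\<^sub>F q in nhds (?l 0). f q = 0"
          using b by (simp add: Z_def xy)
        moreover have "(?l \<longlongrightarrow> ?l 0) (nhds 0)"
          by (intro tendsto_intros filterlim_ident)
        ultimately have "\<forall>\<^sub>F t in nhds 0. f (?l t) = 0"
          by (rule eventually_compose_filterlim)
        then obtain d where d: "d > 0" "\<And>t. dist t 0 < d \<Longrightarrow> f (?l t) = 0"
          by (auto simp: eventually_nhds_metric)
        have 0: "0 \<in> ?T" and 1: "1 \<in> ?T" using b c xy uv by auto
        have "f (?l 1) = 0"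
        proof (rule analytic_continuation[OF hol opT conn _ 0 _ _ 1, of "ball 0 d \<inter> ?T"])
          show "0 islimpt ball 0 d \<inter> ?T"
            using d(1) 0 opT by (intro interior_limit_point) (auto simp: interior_open open_Int)
        qed (use d in \<open>auto simp: dist_commute\<close>)
        then show ?thesis by (simp add: uv)
      qed
      then have "a \<in> Z"
        unfolding Z_def using r(1) by (auto simp: eventually_nhds_metric dist_commute)
      with a show False by blast
    qed
    with r show "\<exists>T. open T \<and> a \<in> T \<and> T \<subseteq> \<Omega> - Z"
      by (intro exI[of _ "ball a r"]) auto
  qed
  moreover have "\<Omega> \<inter> Z \<noteq> {}" using p z by (auto simp: Z_def)
  ultimately have "\<Omega> \<subseteq> Z"
    using \<Omega>(2) unfolding connected_def by blast
  with q show ?thesis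
    by (auto simp: Z_def dest: eventually_nhds_x_imp_x)
qed

subsection \<open>The Schwarz lemma\<close>

lemma Schwarz_ball:
  assumes h: "h holomorphic_on ball 0 R" and M: "\<And>z. z \<in> ball 0 R \<Longrightarrow> cmod (h z) \<le> M"
    and h0: "h 0 = 0" and z: "z \<in> ball 0 R"
  shows "cmod (h z) \<le> M * (cmod z / R)"
proof -
  have R: "R > 0" using z by (metis ball_empty empty_iff not_less)
  have M0: "0 \<le> M" using M[of 0] R h0 by simp
  have "cmod (h z) \<le> M * (cmod z / R) + e" if e: "e > 0" for e
  proof -
    \<comment> \<open>The slack e makes |g| strictly less than 1, as the Schwarz lemma on the unit
      disc requires, and keeps the denominator positive when M = 0. It is removed at the end by
      letting e tend to 0.\<close>
    define g where "g = (\<lambda>w. h (of_real R * w) / of_real (M + e))"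
    have in_ball: "of_real R * w \<in> ball 0 R" if "cmod w < 1" for w :: complex
      using that R by (simp add: norm_mult)
    have "(h \<circ> (\<lambda>w. of_real R * w)) holomorphic_on ball 0 1"
      by (rule holomorphic_on_compose_gen[OF _ h]) (auto intro!: holomorphic_intros in_ball simp del: mem_ball simp: dist_norm)
    then have "g holomorphic_on ball 0 1"
      unfolding g_def comp_def using M0 e by (intro holomorphic_intros) (auto simp flip: of_real_add)
    moreover have "cmod (g w) < 1" if "cmod w < 1" for w
      using M[OF in_ball[OF that]] M0 e by (simp add: g_def norm_divide del: of_real_add)
    moreover have "cmod (z / of_real R) < 1"
      using z R by (simp add: norm_divide)
    ultimately have "cmod (g (z / of_real R)) \<le> cmod (z / of_real R)"
      using h0 by (intro Schwarz_Lemma(1)) (auto simp: g_def)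
    then have "cmod (h z) / (M + e) \<le> cmod z / R"
      using R M0 e by (simp add: g_def norm_divide del: of_real_add)
    then have "cmod (h z) \<le> (M + e) * (cmod z / R)"
      using M0 e by (simp add: field_simps)
    also have "\<dots> \<le> M * (cmod z / R) + e"
      using z R e by (simp add: field_simps)
    finally show ?thesis .
  qed
  then show ?thesis by (rule field_le_epsilon)
qed

text \<open>The hypothesis h/z^n -> 0 encodes vanishing to order at least n + 1, whence the exponent
  \<open>Suc n\<close>; integrability delivers orders in this form. Each induction step divides by
  z: the one-step Schwarz bound shows that h(z)/z is bounded by M/R, and its limit condition has
  exponent n - 1.\<close>

lemma Schwarz_ball_order:
  assumes "h holomorphic_on ball 0 R" "\<And>z. z \<in> ball 0 R \<Longrightarrow> cmod (h z) \<le> M"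
    and "((\<lambda>z. h z / z ^ n) \<longlongrightarrow> 0) (at 0)" "z \<in> ball 0 R"
  shows "cmod (h z) \<le> M * (cmod z / R) ^ (Suc n)"
  using assms
proof (induction n arbitrary: h M z)
  case (0 h M z)
  have R: "R > 0" using 0(4) by (metis ball_empty empty_iff not_less)
  have "isCont h 0"
    using 0(1) R by (metis centre_in_ball continuous_on_eq_continuous_at holomorphic_on_imp_continuous_on open_ball)
  then have "h 0 = 0"
    using 0(3) LIM_unique[of h _ 0 0] by (simp add: isCont_def)
  then show ?case using Schwarz_ball[OF 0(1,2) _ 0(4)] by simp
next
  case (Suc n h M z)
  have R: "R > 0" using Suc.prems(4) by (metis ball_empty empty_iff not_less)
  define g where "g = (\<lambda>z. if z = 0 then deriv h 0 else h z / z)"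
  have cont: "isCont h 0"
    using Suc.prems(1) R by (metis centre_in_ball continuous_on_eq_continuous_at holomorphic_on_imp_continuous_on open_ball)
  have "((\<lambda>z. h z / z ^ Suc n * z ^ Suc n) \<longlongrightarrow> 0 * 0 ^ Suc n) (at 0)"
    by (intro tendsto_intros Suc.prems(3))
  moreover have "\<forall>\<^sub>F z in at 0. h z / z ^ Suc n * z ^ Suc n = h z"
    by (auto simp: eventually_at intro!: exI[of _ 1])
  ultimately have "(h \<longlongrightarrow> 0) (at 0)"
    by (simp add: filterlim_cong)
  then have h0: "h 0 = 0"
    using cont LIM_unique[of h _ 0 0] by (simp add: isCont_def)
  have g: "g holomorphic_on ball 0 R"
    by (rule pole_theorem_0[OF Suc.prems(1), of 0]) (use R h0 in \<open>auto simp: g_def\<close>)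
  have gM': "cmod (g w) \<le> M / R" if "w \<in> ball 0 R" "w \<noteq> 0" for w
    using Schwarz_ball[OF Suc.prems(1,2) h0 that(1)] that R by (simp add: g_def norm_divide field_simps)
  have gM: "cmod (g w) \<le> M / R" if "w \<in> ball 0 R" for w
  proof (cases "w = 0")
    case True
    have "isCont g 0"
      using g R by (metis centre_in_ball continuous_on_eq_continuous_at holomorphic_on_imp_continuous_on open_ball)
    then have "((\<lambda>w. cmod (g w)) \<longlongrightarrow> cmod (g 0)) (at 0)"
      unfolding isCont_def by (rule tendsto_norm)
    moreover have "\<forall>\<^sub>F w in at 0. cmod (g w) \<le> M / R"
      using R gM' by (auto simp: eventually_at dist_norm intro!: exI[of _ R])
    ultimately show ?thesis
      using True by (intro tendsto_upperbound[of _ _ "at 0"]) auto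
  qed (use gM' that in auto)
  have "\<forall>\<^sub>F z in at 0. h z / z ^ Suc n = g z / z ^ n"
    by (auto simp: eventually_at g_def intro!: exI[of _ 1])
  then have "((\<lambda>z. g z / z ^ n) \<longlongrightarrow> 0) (at 0)"
    using Suc.prems(3) by (simp add: filterlim_cong)
  from Suc.IH[OF g gM this Suc.prems(4)]
  have "cmod (g z) \<le> M / R * (cmod z / R) ^ Suc n" .
  moreover have "h z = z * g z" using h0 by (simp add: g_def)
  ultimately have "cmod (h z) \<le> cmod z * (M / R * (cmod z / R) ^ Suc n)"
    by (metis mult_left_mono norm_ge_zero norm_mult)
  then show ?case by (simp add: mult_ac)
qed

subsection \<open>Bergman kernels\<close>

lemma cmod_add_power2_le: "(cmod (a + b))\<^sup>2 \<le> 2 * (cmod a)\<^sup>2 + 2 * (cmod b)\<^sup>2"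
proof -
  have "(cmod (a + b))\<^sup>2 \<le> (cmod a + cmod b)\<^sup>2"
    by (intro power_mono norm_triangle_ineq) simp
  also have "\<dots> \<le> 2 * (cmod a)\<^sup>2 + 2 * (cmod b)\<^sup>2"
    using sum_squares_ge_zero[of "cmod a - cmod b" 0] by (simp add: power2_eq_square algebra_simps)
  finally show ?thesis .
qed

section \<open>Linear structure and norms of the weighted spaces\<close>

lemma holomorphic2_on_weighted_measurable:
  assumes "holomorphic2_on f \<Omega>" "open \<Omega>"
  shows "f \<in> borel_measurable (weighted_measure \<Omega> \<phi> m)"
proof -
  have "f \<in> borel_measurable (restrict_space borel \<Omega>)"
    using assms by (intro borel_measurable_continuous_on_restrict holomorphic2_imp_continuous_on)
  moreover have "sets (weighted_measure \<Omega> \<phi> m) = sets (restrict_space borel \<Omega>)"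
    unfolding weighted_measure_def sets_density by (intro sets_restrict_space_cong) simp
  ultimately show ?thesis
    using measurable_cong_sets by blast
qed

lemma bergman_space_measurable:
  "f \<in> bergman_space \<Omega> \<phi> m \<Longrightarrow> open \<Omega> \<Longrightarrow> f \<in> borel_measurable (weighted_measure \<Omega> \<phi> m)"
  by (simp add: bergman_space_def holomorphic2_on_weighted_measurable)

lemma bergman_space_integrable_mult_cnj:
  assumes "f \<in> bergman_space \<Omega> \<phi> m" "g \<in> bergman_space \<Omega> \<phi> m" "open \<Omega>"
  shows "integrable (weighted_measure \<Omega> \<phi> m) (\<lambda>p. f p * cnj (g p))"
proof (rule Bochner_Integration.integrable_bound)
  have [measurable]: "f \<in> borel_measurable (weighted_measure \<Omega> \<phi> m)" "g \<in> borel_measurable (weighted_measure \<Omega> \<phi> m)"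
    using assms bergman_space_measurable by blast+
  have [measurable]: "(\<lambda>p. cnj (g p)) \<in> borel_measurable (weighted_measure \<Omega> \<phi> m)"
    by (rule measurable_compose[where g = cnj and N = borel])
       (auto intro!: borel_measurable_continuous_onI continuous_intros)
  show "(\<lambda>p. f p * cnj (g p)) \<in> borel_measurable (weighted_measure \<Omega> \<phi> m)" by measurable
  show "integrable (weighted_measure \<Omega> \<phi> m) (\<lambda>p. (cmod (f p))\<^sup>2 + (cmod (g p))\<^sup>2)"
    using assms by (simp add: bergman_space_def)
  have "a * b \<le> a\<^sup>2 + b\<^sup>2" for a b :: real
    using sum_squares_bound[of a b] zero_le_power2[of a] zero_le_power2[of b] by linarith
  then show "AE p in weighted_measure \<Omega> \<phi> m. norm (f p * cnj (g p)) \<le> norm ((cmod (f p))\<^sup>2 + (cmod (g p))\<^sup>2)"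
    by (simp add: norm_mult)
qed

lemma bergman_space_add:
  assumes "f \<in> bergman_space \<Omega> \<phi> m" "g \<in> bergman_space \<Omega> \<phi> m" "open \<Omega>"
  shows "(\<lambda>p. f p + g p) \<in> bergman_space \<Omega> \<phi> m"
proof -
  have hol: "holomorphic2_on (\<lambda>p. f p + g p) \<Omega>"
    using holomorphic2_on_sum[of UNIV "\<lambda>b. if b then f else g" \<Omega>] assms
    by (simp add: bergman_space_def UNIV_bool add.commute split: if_splits)
  have "integrable (weighted_measure \<Omega> \<phi> m) (\<lambda>p. (cmod (f p + g p))\<^sup>2)"
  proof (rule Bochner_Integration.integrable_bound)
    show "integrable (weighted_measure \<Omega> \<phi> m) (\<lambda>p. 2 * (cmod (f p))\<^sup>2 + 2 * (cmod (g p))\<^sup>2)"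
      using assms by (simp add: bergman_space_def)
    show "(\<lambda>p. (cmod (f p + g p))\<^sup>2) \<in> borel_measurable (weighted_measure \<Omega> \<phi> m)"
      using holomorphic2_on_weighted_measurable[OF hol assms(3)] by measurable
  qed (simp add: cmod_add_power2_le)
  with hol show ?thesis by (simp add: bergman_space_def)
qed

lemma bergman_space_scale:
  assumes "f \<in> bergman_space \<Omega> \<phi> m"
  shows "(\<lambda>p. c * f p) \<in> bergman_space \<Omega> \<phi> m"
  using assms holomorphic2_on_mult[OF holomorphic2_on_const[of c]]
  by (simp add: bergman_space_def norm_mult power_mult_distrib)

lemma bergman_space_zero: "(\<lambda>p. 0) \<in> bergman_space \<Omega> \<phi> m"
  by (simp add: bergman_space_def holomorphic2_on_const)

lemma bergman_space_sum:
  assumes "finite F" "F \<subseteq> bergman_space \<Omega> \<phi> m" "open \<Omega>"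
  shows "(\<lambda>p. \<Sum>s\<in>F. c s * s p) \<in> bergman_space \<Omega> \<phi> m"
  using assms
proof (induction F rule: finite_induct)
  case empty
  then show ?case by (simp add: bergman_space_zero)
next
  case (insert s F)
  then show ?case
    by (simp add: bergman_space_add bergman_space_scale)
qed

lemma bergman_space_diff:
  assumes "f \<in> bergman_space \<Omega> \<phi> m" "g \<in> bergman_space \<Omega> \<phi> m" "open \<Omega>"
  shows "(\<lambda>p. f p - g p) \<in> bergman_space \<Omega> \<phi> m"
  using bergman_space_add[OF assms(1) bergman_space_scale[OF assms(2), of "-1"] assms(3)] by simp

lemma bergman_norm_nonneg: "0 \<le> bergman_norm \<Omega> \<phi> m f"
  by (simp add: bergman_norm_def)

lemma bergman_norm_power2:
  "(bergman_norm \<Omega> \<phi> m f)\<^sup>2 = (LINT p|weighted_measure \<Omega> \<phi> m. (cmod (f p))\<^sup>2)"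
  by (simp add: bergman_norm_def)

lemma bergman_norm_add_power2_le:
  assumes "f \<in> bergman_space \<Omega> \<phi> m" "g \<in> bergman_space \<Omega> \<phi> m" "open \<Omega>"
  shows "(bergman_norm \<Omega> \<phi> m (\<lambda>p. f p + g p))\<^sup>2
    \<le> 2 * (bergman_norm \<Omega> \<phi> m f)\<^sup>2 + 2 * (bergman_norm \<Omega> \<phi> m g)\<^sup>2"
proof -
  have "(LINT p|weighted_measure \<Omega> \<phi> m. (cmod (f p + g p))\<^sup>2)
      \<le> (LINT p|weighted_measure \<Omega> \<phi> m. 2 * (cmod (f p))\<^sup>2 + 2 * (cmod (g p))\<^sup>2)"
    using assms bergman_space_add[OF assms]
    by (intro integral_mono cmod_add_power2_le) (auto simp: bergman_space_def)
  also have "\<dots> = 2 * (LINT p|weighted_measure \<Omega> \<phi> m. (cmod (f p))\<^sup>2) + 2 * (LINT p|weighted_measure \<Omega> \<phi> m. (cmod (g p))\<^sup>2)"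
    using assms by (simp add: bergman_space_def)
  finally show ?thesis by (simp add: bergman_norm_power2)
qed

lemma bergman_norm_orthonormal_sum:
  assumes B: "orthonormal_basis \<Omega> \<phi> m B" and F: "finite F" "F \<subseteq> B" and \<Omega>: "open \<Omega>"
  shows "(bergman_norm \<Omega> \<phi> m (\<lambda>p. \<Sum>s\<in>F. c s * s p))\<^sup>2 = (\<Sum>s\<in>F. (cmod (c s))\<^sup>2)"
proof -
  let ?M = "weighted_measure \<Omega> \<phi> m"
  have H: "s \<in> bergman_space \<Omega> \<phi> m" if "s \<in> F" for s
    using B F that by (auto simp: orthonormal_basis_def)
  have inner: "(LINT p|?M. s p * cnj (t p)) = (if s = t then 1 else 0)" if "s \<in> F" "t \<in> F" for s t
    using B F that by (auto simp: orthonormal_basis_def bergman_inner_def subset_iff)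
  have int: "integrable ?M (\<lambda>p. c s * cnj (c t) * (s p * cnj (t p)))" if "s \<in> F" "t \<in> F" for s t
    using bergman_space_integrable_mult_cnj[OF H[OF that(1)] H[OF that(2)] \<Omega>] by simp
  have "complex_of_real ((bergman_norm \<Omega> \<phi> m (\<lambda>p. \<Sum>s\<in>F. c s * s p))\<^sup>2)
      = (LINT p|?M. complex_of_real ((cmod (\<Sum>s\<in>F. c s * s p))\<^sup>2))"
    by (simp add: bergman_norm_power2 del: of_real_power)
  also have "\<dots> = (LINT p|?M. (\<Sum>s\<in>F. \<Sum>t\<in>F. c s * cnj (c t) * (s p * cnj (t p))))"
  proof (rule Bochner_Integration.integral_cong[OF refl])
    fix p
    have "complex_of_real ((cmod (\<Sum>s\<in>F. c s * s p))\<^sup>2) = (\<Sum>s\<in>F. c s * s p) * (\<Sum>t\<in>F. cnj (c t * t p))"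
      unfolding complex_norm_square by simp
    then show "complex_of_real ((cmod (\<Sum>s\<in>F. c s * s p))\<^sup>2) = (\<Sum>s\<in>F. \<Sum>t\<in>F. c s * cnj (c t) * (s p * cnj (t p)))"
      by (simp add: sum_product mult_ac)
  qed
  also have "\<dots> = (\<Sum>s\<in>F. \<Sum>t\<in>F. (LINT p|?M. c s * cnj (c t) * (s p * cnj (t p))))"
    using int by (simp add: Bochner_Integration.integral_sum)
  also have "\<dots> = (\<Sum>s\<in>F. \<Sum>t\<in>F. if s = t then c s * cnj (c t) else 0)"
    by (intro sum.cong refl) (simp add: inner)
  also have "\<dots> = complex_of_real (\<Sum>s\<in>F. (cmod (c s))\<^sup>2)"
    unfolding of_real_sum complex_norm_square using F(1) by simp
  finally show ?thesis
    using of_real_eq_iff by blast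
qed

lemma sum_cmod_square_le_infsum:
  assumes "finite F" "F \<subseteq> B"
  shows "ennreal (\<Sum>s\<in>F. (cmod (s p))\<^sup>2) \<le> (\<Sum>\<^sub>\<infinity>s\<in>B. ennreal ((cmod (s p))\<^sup>2))"
proof -
  have "ennreal (\<Sum>s\<in>F. (cmod (s p))\<^sup>2) = (\<Sum>s\<in>F. ennreal ((cmod (s p))\<^sup>2))"
    by (simp add: sum_ennreal)
  also have "\<dots> \<le> (\<Sum>\<^sub>\<infinity>s\<in>B. ennreal ((cmod (s p))\<^sup>2))"
    unfolding nonneg_infsum_complete[OF zero_le] using assms by (intro SUP_upper) auto
  finally show ?thesis .
qed

text \<open>For a finite part F of the basis, the combination with coefficients
  \<open>cnj (s p)\<close> has both its value at p and its squared norm equal to the partial sum S.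
  The evaluation bound therefore reads S^2 \<le> A S, so S \<le> A unless S = 0.\<close>

lemma bergman_kernel_le:
  assumes B: "orthonormal_basis \<Omega> \<phi> m B" and \<Omega>: "open \<Omega>"
    and A: "\<And>g. g \<in> bergman_space \<Omega> \<phi> m \<Longrightarrow> (cmod (g p))\<^sup>2 \<le> A * (bergman_norm \<Omega> \<phi> m g)\<^sup>2"
  shows "(\<Sum>\<^sub>\<infinity>s\<in>B. ennreal ((cmod (s p))\<^sup>2)) \<le> ennreal A"
  unfolding nonneg_infsum_complete[OF zero_le]
proof (rule SUP_least)
  fix F assume "F \<in> {F. finite F \<and> F \<subseteq> B}"
  then have F: "finite F" "F \<subseteq> B" by auto
  let ?S = "\<Sum>s\<in>F. (cmod (s p))\<^sup>2"
  let ?g = "\<lambda>q. \<Sum>s\<in>F. cnj (s p) * s q"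
  have "?g \<in> bergman_space \<Omega> \<phi> m"
    using B F \<Omega> by (intro bergman_space_sum) (auto simp: orthonormal_basis_def)
  from A[OF this] have *: "(cmod (?g p))\<^sup>2 \<le> A * ?S"
    by (simp add: bergman_norm_orthonormal_sum[OF B F \<Omega>])
  have g: "?g p = complex_of_real ?S"
    unfolding of_real_sum complex_norm_square by (simp add: mult.commute)
  have "0 \<le> ?S" by (simp add: sum_nonneg)
  have "cmod (?g p) = ?S"
    unfolding g norm_of_real using \<open>0 \<le> ?S\<close> by (rule abs_of_nonneg)
  with * have "?S * ?S \<le> A * ?S"
    by (simp only: power2_eq_square)
  with \<open>0 \<le> ?S\<close> have "?S \<le> A \<or> ?S = 0"
    using mult_right_le_imp_le[of ?S ?S A] by argo
  then have "ennreal ?S \<le> ennreal A"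
    by (elim disjE) (simp_all only: ennreal_leI ennreal_0 zero_le)
  then show "(\<Sum>s\<in>F. ennreal ((cmod (s p))\<^sup>2)) \<le> ennreal A"
    by (simp add: sum_ennreal)
qed

text \<open>Density of the span provides a finite combination g close to f in norm; Cauchy-Schwarz
  bounds g(p) by the kernel, and the evaluation bound A controls the error f(p) - g(p). The factor 4
  comes from using |a + b|^2 \<le> 2|a|^2 + 2|b|^2 twice, once for the norm of g and once for the
  value of f. It is harmless, since after taking logarithms constants only shift by O(1). The bound
  A also makes the kernel finite.\<close>

lemma bergman_kernel_ge:
  assumes B: "orthonormal_basis \<Omega> \<phi> m B" and \<Omega>: "open \<Omega>" and "0 \<le> A"
    and A: "\<And>g. g \<in> bergman_space \<Omega> \<phi> m \<Longrightarrow> (cmod (g p))\<^sup>2 \<le> A * (bergman_norm \<Omega> \<phi> m g)\<^sup>2"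
    and f: "f \<in> bergman_space \<Omega> \<phi> m"
  shows "ennreal ((cmod (f p))\<^sup>2) \<le> ennreal (4 * (bergman_norm \<Omega> \<phi> m f)\<^sup>2) * (\<Sum>\<^sub>\<infinity>s\<in>B. ennreal ((cmod (s p))\<^sup>2))"
proof -
  let ?n = "bergman_norm \<Omega> \<phi> m"
  define K where "K = (\<Sum>\<^sub>\<infinity>s\<in>B. ennreal ((cmod (s p))\<^sup>2))"
  define k where "k = enn2real K"
  have "K \<le> ennreal A"
    unfolding K_def using B \<Omega> A by (rule bergman_kernel_le)
  then have K: "K = ennreal k"
    by (metis ennreal_enn2real k_def ennreal_less_top order_le_less_trans)
  have k0: "0 \<le> k" by (simp add: k_def)
  have est: "(cmod (f p))\<^sup>2 \<le> 4 * (?n f)\<^sup>2 * k + \<epsilon>\<^sup>2 * (2 * A + 4 * k)" if "\<epsilon> > 0" for \<epsilon>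
  proof -
    have "\<forall>f\<in>bergman_space \<Omega> \<phi> m. \<forall>\<epsilon>>0. \<exists>F c. finite F \<and> F \<subseteq> B \<and>
        ?n (\<lambda>p. f p - (\<Sum>s\<in>F. c s * s p)) < \<epsilon>"
      using B unfolding orthonormal_basis_def by (elim conjE)
    from this[rule_format, OF f that]
    obtain F c where F: "finite F" "F \<subseteq> B" and small: "?n (\<lambda>p. f p - (\<Sum>s\<in>F. c s * s p)) < \<epsilon>"
      by (elim exE conjE) (rule that)
    let ?g = "\<lambda>p. \<Sum>s\<in>F. c s * s p"
    have g: "?g \<in> bergman_space \<Omega> \<phi> m"
      using B F \<Omega> by (intro bergman_space_sum) (auto simp: orthonormal_basis_def)
    have d: "(\<lambda>p. f p - ?g p) \<in> bergman_space \<Omega> \<phi> m"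
      using f g \<Omega> by (rule bergman_space_diff)
    have d': "(\<lambda>p. ?g p - f p) \<in> bergman_space \<Omega> \<phi> m"
      using g f \<Omega> by (rule bergman_space_diff)
    have n: "(?n (\<lambda>p. f p - ?g p))\<^sup>2 \<le> \<epsilon>\<^sup>2"
      using small bergman_norm_nonneg by (intro power_mono) auto
    have n': "(?n (\<lambda>p. ?g p - f p))\<^sup>2 \<le> \<epsilon>\<^sup>2"
      using n by (simp add: bergman_norm_power2 norm_minus_commute)
    have "(?n ?g)\<^sup>2 \<le> 2 * (?n f)\<^sup>2 + 2 * \<epsilon>\<^sup>2"
      using bergman_norm_add_power2_le[OF f d' \<Omega>] n' by simp
    moreover have "(cmod (?g p))\<^sup>2 \<le> (?n ?g)\<^sup>2 * k"
    proof -
      have "(cmod (?g p))\<^sup>2 \<le> (\<Sum>s\<in>F. cmod (c s) * cmod (s p))\<^sup>2"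
        by (intro power_mono) (auto intro!: sum_norm_le simp: norm_mult)
      also have "\<dots> \<le> (\<Sum>s\<in>F. (cmod (c s))\<^sup>2) * (\<Sum>s\<in>F. (cmod (s p))\<^sup>2)"
        by (rule Cauchy_Schwarz_ineq_sum)
      also have "\<dots> \<le> (\<Sum>s\<in>F. (cmod (c s))\<^sup>2) * k"
        using sum_cmod_square_le_infsum[OF F, of p] k0
        by (intro mult_left_mono) (auto simp: K_def[symmetric] K intro: sum_nonneg)
      finally show ?thesis
        by (simp add: bergman_norm_orthonormal_sum[OF B F \<Omega>])
    qed
    ultimately have gp: "(cmod (?g p))\<^sup>2 \<le> (2 * (?n f)\<^sup>2 + 2 * \<epsilon>\<^sup>2) * k"
      using k0 by (meson mult_right_mono order_trans)
    have dp: "(cmod (f p - ?g p))\<^sup>2 \<le> A * \<epsilon>\<^sup>2"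
      using A[OF d] n \<open>0 \<le> A\<close> by (meson mult_left_mono order_trans)
    have "(cmod (f p))\<^sup>2 \<le> 2 * (cmod (f p - ?g p))\<^sup>2 + 2 * (cmod (?g p))\<^sup>2"
      using cmod_add_power2_le[of "f p - ?g p" "?g p"] by simp
    also have "\<dots> \<le> 2 * (A * \<epsilon>\<^sup>2) + 2 * ((2 * (?n f)\<^sup>2 + 2 * \<epsilon>\<^sup>2) * k)"
      using gp dp by linarith
    finally show ?thesis by (simp add: algebra_simps)
  qed
  have "((\<lambda>\<epsilon>. 4 * (?n f)\<^sup>2 * k + \<epsilon>\<^sup>2 * (2 * A + 4 * k)) \<longlongrightarrow> 4 * (?n f)\<^sup>2 * k + 0\<^sup>2 * (2 * A + 4 * k)) (at_right 0)"
    by (intro tendsto_intros)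
  then have "(cmod (f p))\<^sup>2 \<le> 4 * (?n f)\<^sup>2 * k + 0\<^sup>2 * (2 * A + 4 * k)"
    by (rule tendsto_lowerbound) (auto simp: eventually_at_right_less est intro: eventually_mono[OF eventually_at_right_less])
  then have "ennreal ((cmod (f p))\<^sup>2) \<le> ennreal (4 * (?n f)\<^sup>2 * k)"
    by (intro ennreal_leI) simp
  also have "\<dots> = ennreal (4 * (?n f)\<^sup>2) * K"
    by (simp add: K ennreal_mult k0)
  finally show ?thesis by (simp add: K_def)
qed

subsection \<open>The weight of three lines\<close>

lemma elog_ennreal: "0 < t \<Longrightarrow> elog (ennreal t) = ereal (ln t)"
  by (simp add: elog_def ennreal_eq_0_iff)

text \<open>The product of the equations of the three lines: off its zero set \<phi> is (4/3) log
  |xyz|, which is the origin of the exponent 4m/3 in the weight.\<close>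

definition xyz :: "complex \<times> complex \<Rightarrow> complex" where
  "xyz p = fst p * snd p * (fst p + snd p)"

text \<open>On the null set $xyz = 0$ this is $0$, since \<open>0 powr a = 0\<close>, whereas the weight $e^{-m\varphi}$ is $\infty$ there.\<close>

definition xyz_weight :: "nat \<Rightarrow> complex \<times> complex \<Rightarrow> real" where
  "xyz_weight m p = cmod (xyz p) powr (- (4 * real m / 3))"

abbreviation (input) phi_xyz :: "complex \<times> complex \<Rightarrow> ereal" where
  "phi_xyz \<equiv> phi_D (2/3) (2/3) (2/3)"

lemma exp_weight_phi_xyz:
  "exp_weight phi_xyz m p = (if xyz p = 0 then \<infinity> else ennreal (xyz_weight m p))"
proof (cases "xyz p = 0")
  case True
  \<comment> \<open>No summand is +\<infinity>, so a single summand -\<infinity> determines the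
    whole sum, without any undefined difference of infinities.\<close>
  have ninf: "ereal (2/3) * elog (ennreal ((cmod z)\<^sup>2)) \<noteq> \<infinity>" for z
    by (cases "z = 0") (auto simp: elog_def ennreal_eq_0_iff)
  have z: "ereal (2/3) * elog (ennreal ((cmod 0)\<^sup>2)) = -\<infinity>"
    by (simp add: elog_def)
  have "fst p = 0 \<or> snd p = 0 \<or> fst p + snd p = 0"
    using True by (simp add: xyz_def)
  then have "phi_xyz p = -\<infinity>"
    unfolding phi_D_def case_prod_unfold using z
      ninf[of "fst p"] ninf[of "snd p"] ninf[of "fst p + snd p"]
    by (elim disjE; simp only:) (auto simp: plus_ereal.simps ereal_plus_eq_MInfty)
  then show ?thesis using True by (simp add: exp_weight_def)
next
  case False
  then have nz: "fst p \<noteq> 0" "snd p \<noteq> 0" "fst p + snd p \<noteq> 0" by (auto simp: xyz_def)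
  have e: "elog (ennreal ((cmod z)\<^sup>2)) = ereal (2 * ln (cmod z))" if "z \<noteq> 0" for z
    using that by (simp add: elog_ennreal ln_realpow)
  have "phi_xyz p = ereal (4/3 * ln (cmod (xyz p)))"
  proof -
    have "ln (cmod (xyz p)) = ln (cmod (fst p)) + ln (cmod (snd p)) + ln (cmod (fst p + snd p))"
      using nz by (simp add: xyz_def norm_mult ln_mult)
    then show ?thesis
      using nz by (simp add: phi_D_def case_prod_unfold e)
  qed
  then show ?thesis
    using False by (simp add: exp_weight_def xyz_weight_def powr_def field_simps)
qed

lemma continuous_on_xyz [continuous_intros]: "continuous_on S xyz"
  unfolding xyz_def by (intro continuous_intros)

lemma xyz_measurable [measurable]: "xyz \<in> borel_measurable borel"
  by (intro borel_measurable_continuous_onI continuous_intros)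

lemma xyz_weight_measurable [measurable]: "xyz_weight m \<in> borel_measurable borel"
  unfolding xyz_weight_def by measurable

lemma xyz_weight_nonneg: "0 \<le> xyz_weight m p"
  by (simp add: xyz_weight_def)

text \<open>Each of the three complex lines lies in the real hyperplane on which the real part of
  its equation vanishes, and real hyperplanes are negligible.\<close>

lemma AE_xyz_nonzero: "AE p in lborel. xyz p \<noteq> 0"
proof -
  let ?N = "\<lambda>a::complex \<times> complex. {p. a \<bullet> p = 0}"
  have "negligible (?N (1, 0) \<union> ?N (0, 1) \<union> ?N (1, 1))"
    by (intro negligible_Un negligible_hyperplane) (auto simp: zero_prod_def)
  then have N: "AE p in lebesgue. p \<notin> ?N (1, 0) \<union> ?N (0, 1) \<union> ?N (1, 1)"
    unfolding negligible_iff_null_sets by (rule AE_not_in)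
  have "p \<in> ?N (1, 0) \<union> ?N (0, 1) \<union> ?N (1, 1)" if "xyz p = 0" for p
  proof -
    have "fst p = 0 \<or> snd p = 0 \<or> fst p + snd p = 0"
      using that by (simp add: xyz_def)
    then show ?thesis
      by (elim disjE) (auto simp: inner_prod_def inner_complex_def complex_eq_iff)
  qed
  then have "AE p in lebesgue. xyz p \<noteq> 0"
    by (intro eventually_mono[OF N]) blast
  then show ?thesis by (simp add: AE_completion_iff)
qed

lemma weighted_measure_phi_xyz:
  assumes "open \<Omega>"
  shows "weighted_measure \<Omega> phi_xyz m = density (restrict_space lborel \<Omega>) (\<lambda>p. ennreal (xyz_weight m p))"
  unfolding weighted_measure_def
proof (rule density_cong)
  have "exp_weight phi_xyz m \<in> borel_measurable borel"
    unfolding exp_weight_phi_xyz[abs_def] by measurable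
  then show "exp_weight phi_xyz m \<in> borel_measurable (restrict_space lborel \<Omega>)"
    by (intro measurable_restrict_space1) simp
  show "(\<lambda>p. ennreal (xyz_weight m p)) \<in> borel_measurable (restrict_space lborel \<Omega>)"
    by (intro measurable_restrict_space1) simp
  show "AE p in restrict_space lborel \<Omega>. exp_weight phi_xyz m p = ennreal (xyz_weight m p)"
    using AE_xyz_nonzero assms
    by (subst AE_restrict_space_iff) (auto simp: exp_weight_phi_xyz elim!: eventually_mono)
qed

lemma nn_integral_weighted_measure:
  assumes \<Omega>: "open \<Omega>" and f: "holomorphic2_on f \<Omega>"
  shows "(\<integral>\<^sup>+p. ennreal ((cmod (f p))\<^sup>2) \<partial>weighted_measure \<Omega> phi_xyz m)
    = (\<integral>\<^sup>+p\<in>\<Omega>. ennreal (xyz_weight m p * (cmod (f p))\<^sup>2) \<partial>lborel)"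
proof -
  have "f \<in> borel_measurable (restrict_space borel \<Omega>)"
    using f \<Omega> by (intro borel_measurable_continuous_on_restrict holomorphic2_imp_continuous_on)
  then have [measurable]: "f \<in> borel_measurable (restrict_space lborel \<Omega>)"
    by (simp add: measurable_def space_restrict_space sets_restrict_space)
  have [measurable]: "xyz_weight m \<in> borel_measurable (restrict_space lborel \<Omega>)"
    by (intro measurable_restrict_space1) simp
  have "(\<integral>\<^sup>+p. ennreal ((cmod (f p))\<^sup>2) \<partial>weighted_measure \<Omega> phi_xyz m)
      = (\<integral>\<^sup>+p. ennreal (xyz_weight m p) * ennreal ((cmod (f p))\<^sup>2) \<partial>restrict_space lborel \<Omega>)"
    unfolding weighted_measure_phi_xyz[OF \<Omega>] by (rule nn_integral_density) measurable
  also have "\<dots> = (\<integral>\<^sup>+p\<in>\<Omega>. ennreal (xyz_weight m p) * ennreal ((cmod (f p))\<^sup>2) \<partial>lborel)"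
    using \<Omega> by (subst nn_integral_restrict_space) auto
  finally show ?thesis
    by (simp add: ennreal_mult xyz_weight_nonneg)
qed

lemma bergman_space_xyz_iff:
  assumes "open \<Omega>"
  shows "f \<in> bergman_space \<Omega> phi_xyz m \<longleftrightarrow> holomorphic2_on f \<Omega> \<and>
    (\<integral>\<^sup>+p\<in>\<Omega>. ennreal (xyz_weight m p * (cmod (f p))\<^sup>2) \<partial>lborel) < \<infinity>"
proof (cases "holomorphic2_on f \<Omega>")
  case True
  have [measurable]: "f \<in> borel_measurable (weighted_measure \<Omega> phi_xyz m)"
    using True assms by (rule holomorphic2_on_weighted_measurable)
  have "integrable (weighted_measure \<Omega> phi_xyz m) (\<lambda>p. (cmod (f p))\<^sup>2) \<longleftrightarrow>
      (\<integral>\<^sup>+p. ennreal ((cmod (f p))\<^sup>2) \<partial>weighted_measure \<Omega> phi_xyz m) < \<infinity>"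
    by (simp add: integrable_iff_bounded)
  then show ?thesis
    using True by (simp add: bergman_space_def nn_integral_weighted_measure[OF assms True])
qed (simp add: bergman_space_def)

lemma nn_integral_eq_bergman_norm:
  assumes "open \<Omega>" "f \<in> bergman_space \<Omega> phi_xyz m"
  shows "(\<integral>\<^sup>+p\<in>\<Omega>. ennreal (xyz_weight m p * (cmod (f p))\<^sup>2) \<partial>lborel)
    = ennreal ((bergman_norm \<Omega> phi_xyz m f)\<^sup>2)"
  using assms nn_integral_weighted_measure[of \<Omega> f m]
    nn_integral_eq_integral[of "weighted_measure \<Omega> phi_xyz m" "\<lambda>p. (cmod (f p))\<^sup>2"]
  by (simp add: bergman_space_def bergman_norm_power2)

lemma holomorphic2_on_xyz: "holomorphic2_on xyz \<Omega>"
proof -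
  have "holomorphic2_on (\<lambda>p. (1 * fst p + 0 * snd p) * (0 * fst p + 1 * snd p) * (1 * fst p + 1 * snd p)) \<Omega>"
    by (intro holomorphic2_on_mult holomorphic2_on_linear)
  then show ?thesis by (simp add: xyz_def[abs_def])
qed

lemma bergman_space_shift:
  assumes \<Omega>: "open \<Omega>" and f: "f \<in> bergman_space \<Omega> phi_xyz m"
  shows "(\<lambda>p. xyz p ^ (2 * j) * f p) \<in> bergman_space \<Omega> phi_xyz (m + 3 * j)"
proof (induction j)
  case 0
  then show ?case using f by simp
next
  case (Suc j)
  let ?g = "\<lambda>p. xyz p ^ (2 * j) * f p"
  let ?h = "\<lambda>p. xyz p * (xyz p * (xyz p ^ (2 * j) * f p))"
  have hol: "holomorphic2_on ?h \<Omega>"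
    using Suc by (intro holomorphic2_on_mult[OF holomorphic2_on_xyz]) (simp add: bergman_space_def)
  \<comment> \<open>Off the three lines this is an equality, because 4(m + 3)/3 = 4m/3 + 4 and the
    additional factor xyz^2 has squared modulus |xyz|^4. On the lines the left side is 0.\<close>
  have "xyz_weight (m + 3 * Suc j) p * (cmod (?h p))\<^sup>2 \<le> xyz_weight (m + 3 * j) p * (cmod (?g p))\<^sup>2" for p
  proof (cases "xyz p = 0")
    case True
    then show ?thesis by (simp add: xyz_weight_nonneg)
  next
    case False
    have "xyz_weight (m + 3 * j) p = xyz_weight (m + 3 * Suc j) p * cmod (xyz p) powr 4"
    proof -
      have "- (4 * real (m + 3 * j) / 3) = - (4 * real (m + 3 * Suc j) / 3) + 4"
        by (simp add: add_divide_distrib)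
      then show ?thesis by (simp only: xyz_weight_def powr_add)
    qed
    also have "cmod (xyz p) powr 4 = cmod (xyz p) ^ 4"
      using False by simp
    finally show ?thesis
      by (simp add: norm_mult power_mult_distrib power_mult[symmetric] mult_ac eval_nat_numeral)
  qed
  then have "(\<integral>\<^sup>+p\<in>\<Omega>. ennreal (xyz_weight (m + 3 * Suc j) p * (cmod (?h p))\<^sup>2) \<partial>lborel)
      \<le> (\<integral>\<^sup>+p\<in>\<Omega>. ennreal (xyz_weight (m + 3 * j) p * (cmod (?g p))\<^sup>2) \<partial>lborel)"
    by (intro nn_integral_mono mult_right_mono ennreal_leI) auto
  also have "\<dots> < \<infinity>"
    using Suc by (simp add: bergman_space_xyz_iff[OF \<Omega>])
  finally have "?h \<in> bergman_space \<Omega> phi_xyz (m + 3 * Suc j)"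
    unfolding bergman_space_xyz_iff[OF \<Omega>] using hol by blast
  then show ?case by (simp add: mult.assoc)
qed

section \<open>Pointwise bounds from weighted square integrability\<close>

lemma xyz_weight_ge:
  assumes "cmod (fst q) \<le> a" "cmod (snd q) \<le> b" "cmod (fst q + snd q) \<le> c" "xyz q \<noteq> 0"
  shows "(a * b * c) powr (- (4 * real m / 3)) \<le> xyz_weight m q"
proof -
  have "cmod (xyz q) \<le> a * b * c"
    unfolding xyz_def norm_mult using assms
    by (intro mult_mono) (auto intro: order_trans[OF norm_ge_zero] mult_nonneg_nonneg)
  then show ?thesis
    unfolding xyz_weight_def using assms(4) by (intro powr_mono2') auto
qed

text \<open>The mean value inequality with the weight replaced by a lower bound. That bound is asked
  for only off the null set xyz = 0, where \<open>xyz_weight\<close> is 0 by convention. It serves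
  polydiscs of fixed size, for point evaluations, and polydiscs shrinking towards x = 0, for orders
  of vanishing.\<close>

lemma bergman_local_estimate:
  assumes \<Omega>: "open \<Omega>" and f: "f \<in> bergman_space \<Omega> phi_xyz m"
    and sub: "ball x r \<times> ball y s \<subseteq> \<Omega>" and rs: "0 \<le> r" "0 \<le> s" "0 \<le> c"
    and c: "\<And>q. q \<in> ball x r \<times> ball y s \<Longrightarrow> xyz q \<noteq> 0 \<Longrightarrow> c \<le> xyz_weight m q"
  shows "ennreal (c * (pi\<^sup>2 * r\<^sup>2 * s\<^sup>2) * (cmod (f (x, y)))\<^sup>2)
    \<le> (\<integral>\<^sup>+q\<in>ball x r \<times> ball y s. ennreal (xyz_weight m q * (cmod (f q))\<^sup>2) \<partial>lborel)"
proof -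
  let ?P = "ball x r \<times> ball y s"
  have hol: "holomorphic2_on f \<Omega>" using f by (simp add: bergman_space_def)
  have opP: "open ?P" by (intro open_Times) auto
  have "continuous_on ?P f"
    using hol sub holomorphic2_imp_continuous_on continuous_on_subset by blast
  then have "(\<lambda>q. indicator ?P q *\<^sub>R f q) \<in> borel_measurable borel"
    using opP by (intro borel_measurable_continuous_on_indicator) auto
  then have "(\<lambda>q. ennreal ((cmod (indicator ?P q *\<^sub>R f q))\<^sup>2)) \<in> borel_measurable borel"
    by measurable
  also have "(\<lambda>q. ennreal ((cmod (indicator ?P q *\<^sub>R f q))\<^sup>2)) = (\<lambda>q. ennreal ((cmod (f q))\<^sup>2) * indicator ?P q)"
    by (auto simp: indicator_def)
  finally have meas: "(\<lambda>q. ennreal ((cmod (f q))\<^sup>2) * indicator ?P q) \<in> borel_measurable lborel" by simp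
  have "ennreal (c * (pi\<^sup>2 * r\<^sup>2 * s\<^sup>2) * (cmod (f (x, y)))\<^sup>2)
      = ennreal c * (ennreal ((cmod (f (x, y)))\<^sup>2) * ennreal (pi\<^sup>2 * r\<^sup>2 * s\<^sup>2))"
    using rs by (simp add: ennreal_mult[symmetric] mult_ac)
  also have "\<dots> \<le> ennreal c * (\<integral>\<^sup>+q\<in>?P. ennreal ((cmod (f q))\<^sup>2) \<partial>lborel)"
    using holomorphic2_mean_value_le[OF hol \<Omega> sub] rs
    by (intro mult_left_mono) (simp_all add: emeasure_lborel_polydisc)
  also have "\<dots> = (\<integral>\<^sup>+q. ennreal c * (ennreal ((cmod (f q))\<^sup>2) * indicator ?P q) \<partial>lborel)"
    using meas by (rule nn_integral_cmult[symmetric])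
  also have "\<dots> \<le> (\<integral>\<^sup>+q\<in>?P. ennreal (xyz_weight m q * (cmod (f q))\<^sup>2) \<partial>lborel)"
  proof (rule nn_integral_mono_AE)
    show "AE q in lborel. ennreal c * (ennreal ((cmod (f q))\<^sup>2) * indicator ?P q)
        \<le> ennreal (xyz_weight m q * (cmod (f q))\<^sup>2) * indicator ?P q"
      using AE_xyz_nonzero
    proof eventually_elim
      case (elim q)
      show ?case
      proof (cases "q \<in> ?P")
        case True
        then have "c * (cmod (f q))\<^sup>2 \<le> xyz_weight m q * (cmod (f q))\<^sup>2"
          using c elim by (intro mult_right_mono) auto
        then show ?thesis
          using True rs by (simp add: ennreal_mult[symmetric] ennreal_leI)
      qed simp
    qed
  qed
  finally show ?thesis .
qed

lemma bergman_point_evaluation: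
  assumes \<Omega>: "open \<Omega>" and R: "0 < R" "ball 0 (2 * R) \<times> ball 0 (2 * R) \<subseteq> \<Omega>"
  shows "\<exists>A>0. \<forall>f\<in>bergman_space \<Omega> phi_xyz m. \<forall>x y. cmod x < R \<longrightarrow> cmod y < R
      \<longrightarrow> (cmod (f (x, y)))\<^sup>2 \<le> A * (bergman_norm \<Omega> phi_xyz m f)\<^sup>2"
proof -
  \<comment> \<open>On the polydisc of radius R around (x, y), the quantities |x|, |y| and |x + y|
    are at most 2R, 2R and 4R; the last factor is the volume of that polydisc.\<close>
  define c where "c = (2 * R * (2 * R) * (4 * R)) powr (- (4 * real m / 3)) * (pi\<^sup>2 * R\<^sup>2 * R\<^sup>2)"
  have c: "c > 0" using R by (simp add: c_def)
  show ?thesis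
  proof (intro exI[of _ "1 / c"] conjI ballI allI impI)
    fix f x y assume f: "f \<in> bergman_space \<Omega> phi_xyz m" and xy: "cmod x < R" "cmod y < R"
    have in2: "cmod u < 2 * R" if "u \<in> ball v R" "cmod v < R" for u v
      using that norm_triangle_sub[of u v] by (simp add: dist_norm norm_minus_commute)
    have sub: "ball x R \<times> ball y R \<subseteq> \<Omega>"
      using R(2) in2 xy by (auto simp: subset_iff)
    have "ennreal (c * (cmod (f (x, y)))\<^sup>2)
        \<le> (\<integral>\<^sup>+q\<in>ball x R \<times> ball y R. ennreal (xyz_weight m q * (cmod (f q))\<^sup>2) \<partial>lborel)"
      unfolding c_def
    proof (rule bergman_local_estimate[OF \<Omega> f sub])
      fix q assume q: "q \<in> ball x R \<times> ball y R" "xyz q \<noteq> 0"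
      have "cmod (fst q) < 2 * R" "cmod (snd q) < 2 * R"
        using q in2 xy by auto
      moreover from this have "cmod (fst q + snd q) \<le> 4 * R"
        using norm_triangle_ineq[of "fst q" "snd q"] by linarith
      ultimately show "(2 * R * (2 * R) * (4 * R)) powr (- (4 * real m / 3)) \<le> xyz_weight m q"
        using q by (intro xyz_weight_ge) auto
    qed (use R in auto)
    also have "\<dots> \<le> (\<integral>\<^sup>+q\<in>\<Omega>. ennreal (xyz_weight m q * (cmod (f q))\<^sup>2) \<partial>lborel)"
      using sub by (intro nn_integral_mono mult_left_mono) (auto simp: indicator_def)
    also have "\<dots> = ennreal ((bergman_norm \<Omega> phi_xyz m f)\<^sup>2)"
      by (rule nn_integral_eq_bergman_norm[OF \<Omega> f])
    finally have "c * (cmod (f (x, y)))\<^sup>2 \<le> (bergman_norm \<Omega> phi_xyz m f)\<^sup>2"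
      by (simp add: ennreal_le_iff)
    then show "(cmod (f (x, y)))\<^sup>2 \<le> 1 / c * (bergman_norm \<Omega> phi_xyz m f)\<^sup>2"
      using c by (simp add: field_simps)
  qed (use c in simp)
qed

text \<open>The mean value inequality on a polydisc around $(x, y)$ of radius $|x|/2$ in the first variable
  only gives boundedness; the limit is $0$ because the weighted mass of these polydiscs tends to $0$.\<close>

lemma bergman_vanishing_order:
  assumes \<Omega>: "open \<Omega>" and f: "f \<in> bergman_space \<Omega> phi_xyz m"
    and R: "0 < R" "ball 0 (2 * R) \<times> ball 0 (2 * R) \<subseteq> \<Omega>"
    and y: "y \<noteq> 0" "cmod y < R"
  shows "((\<lambda>x. (cmod (f (x, y)))\<^sup>2 * cmod x powr (2 - 4 * real m / 3)) \<longlongrightarrow> 0) (at 0)"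
proof -
  define s where "s = cmod y / 4"
  \<comment> \<open>On the polydisc of radii |x|/2 and |y|/4 the three linear forms are at most
    3|x|/2, 2|y| and 3|y|, with product 9 |y|^2 |x|. The volume is pi^2 (|x|^2/4) s^2; its factor
    |x|^2 accounts for the 2 in the exponent 2 - 4m/3.\<close>
  define C where "C = (9 * (cmod y)\<^sup>2) powr (- (4 * real m / 3)) * (pi\<^sup>2 / 4 * s\<^sup>2)"
  define \<nu> where "\<nu> = density lborel (\<lambda>q. ennreal (xyz_weight m q * (cmod (f q))\<^sup>2) * indicator \<Omega> q)"
  \<comment> \<open>Removing x = 0 makes the intersection of the slabs empty, so their finite masses
    tend to 0. A polydisc of radius |x|/2 in the first variable stays inside the punctured
    slab.\<close>
  define S where "S = (\<lambda>n::nat. {q::complex \<times> complex. 0 < cmod (fst q) \<and> cmod (fst q) < 1 / (Suc n)})"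
  have s: "s > 0" and C: "C > 0" using y by (auto simp: s_def C_def)
  have opS: "open (S n)" for n
    unfolding S_def by (intro open_Collect_conj open_Collect_less continuous_intros)
  have "f \<in> borel_measurable (restrict_space borel \<Omega>)"
    using f \<Omega> by (intro borel_measurable_continuous_on_restrict holomorphic2_imp_continuous_on)
      (simp add: bergman_space_def)
  then have [measurable]: "(\<lambda>q. indicator \<Omega> q *\<^sub>R f q) \<in> borel_measurable borel"
    using \<Omega> by (subst (asm) borel_measurable_restrict_space_iff) auto
  have "(\<lambda>q. ennreal (xyz_weight m q * (cmod (indicator \<Omega> q *\<^sub>R f q))\<^sup>2)) \<in> borel_measurable borel"
    by measurable
  also have "(\<lambda>q. ennreal (xyz_weight m q * (cmod (indicator \<Omega> q *\<^sub>R f q))\<^sup>2))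
      = (\<lambda>q. ennreal (xyz_weight m q * (cmod (f q))\<^sup>2) * indicator \<Omega> q)"
    by (auto simp: indicator_def)
  finally have meas: "(\<lambda>q. ennreal (xyz_weight m q * (cmod (f q))\<^sup>2) * indicator \<Omega> q) \<in> borel_measurable lborel"
    by simp
  have \<nu>: "emeasure \<nu> A = (\<integral>\<^sup>+q. ennreal (xyz_weight m q * (cmod (f q))\<^sup>2) * indicator \<Omega> q * indicator A q \<partial>lborel)"
    if "A \<in> sets borel" for A
    unfolding \<nu>_def using meas that by (intro emeasure_density) auto
  have "emeasure \<nu> UNIV < \<infinity>"
    using f bergman_space_xyz_iff[OF \<Omega>] by (simp add: \<nu>)
  then have fin: "emeasure \<nu> A \<noteq> \<infinity>" for A
    using emeasure_mono[of A UNIV \<nu>] by (auto simp: \<nu>_def top_unique)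
  have "(\<Inter>n. S n) = {}"
  proof (intro equals0I)
    fix q assume q: "q \<in> (\<Inter>n. S n)"
    then have "q \<in> S 0" by blast
    then have "0 < cmod (fst q)" unfolding S_def by blast
    then obtain n where "1 / real (Suc n) < cmod (fst q)" by (rule nat_approx_posE)
    moreover have "q \<in> S n" using q by blast
    then have "cmod (fst q) < 1 / real (Suc n)" unfolding S_def by blast
    ultimately show False by linarith
  qed
  have "decseq S"
    unfolding decseq_Suc_iff
  proof (intro allI subsetI)
    fix n q assume "q \<in> S (Suc n)"
    moreover have "1 / real (Suc (Suc n)) \<le> 1 / real (Suc n)" by (simp add: frac_le)
    ultimately show "q \<in> S n" unfolding S_def by fastforce
  qed
  have lim: "(\<lambda>n. emeasure \<nu> (S n)) \<longlonglongrightarrow> 0"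
  proof -
    have "range S \<subseteq> sets \<nu>" using opS by (auto simp: \<nu>_def)
    from Lim_emeasure_decseq[OF this \<open>decseq S\<close> fin] show ?thesis
      unfolding \<open>(\<Inter>n. S n) = {}\<close> by simp
  qed
  have est: "ennreal (C * ((cmod (f (x, y)))\<^sup>2 * cmod x powr (2 - 4 * real m / 3))) \<le> emeasure \<nu> (S n)"
    if x: "x \<noteq> 0" "cmod x < cmod y / 2" "2 * cmod x < 1 / Suc n" for x n
  proof -
    define r where "r = cmod x / 2"
    have r: "r > 0" using x by (simp add: r_def)
    have q: "cmod (fst q) \<le> 3 / 2 * cmod x" "cmod (fst q) > 0" "cmod (snd q) < 5 / 4 * cmod y"
      if "q \<in> ball x r \<times> ball y s" for q
    proof -
      have d: "cmod (x - fst q) < r" "cmod (y - snd q) < s"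
        using that by (auto simp: dist_norm)
      show "cmod (fst q) \<le> 3 / 2 * cmod x" "cmod (fst q) > 0" "cmod (snd q) < 5 / 4 * cmod y"
        using d norm_triangle_sub[of "fst q" x] norm_triangle_sub[of x "fst q"] norm_triangle_sub[of "snd q" y] r
        by (auto simp: r_def s_def norm_minus_commute simp del: zero_less_norm_iff)
    qed
    have sub: "ball x r \<times> ball y s \<subseteq> \<Omega> \<inter> S n"
    proof
      fix p assume p: "p \<in> ball x r \<times> ball y s"
      have "p \<in> ball 0 (2 * R) \<times> ball 0 (2 * R)"
        using q[OF p] x y R(1) by (cases p) (auto simp: dist_norm)
      moreover have "cmod (fst p) < 1 / Suc n"
        using q(1)[OF p] x(3) r unfolding r_def by linarith
      ultimately show "p \<in> \<Omega> \<inter> S n"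
        using R(2) q(2)[OF p] by (auto simp: S_def)
    qed
    have "C * ((cmod (f (x, y)))\<^sup>2 * cmod x powr (2 - 4 * real m / 3))
        = (9 * (cmod y)\<^sup>2 * cmod x) powr (- (4 * real m / 3)) * (pi\<^sup>2 * r\<^sup>2 * s\<^sup>2) * (cmod (f (x, y)))\<^sup>2"
    proof -
      have "cmod x powr (2 - 4 * real m / 3) = (cmod x)\<^sup>2 * cmod x powr (- (4 * real m / 3))"
        using x powr_add[of "cmod x" 2 "- (4 * real m / 3)"] by simp
      then show ?thesis
        by (simp add: C_def powr_mult r_def power_divide mult_ac)
    qed
    also have "ennreal \<dots> \<le> (\<integral>\<^sup>+q\<in>ball x r \<times> ball y s. ennreal (xyz_weight m q * (cmod (f q))\<^sup>2) \<partial>lborel)"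
    proof (rule bergman_local_estimate[OF \<Omega> f])
      fix p assume p: "p \<in> ball x r \<times> ball y s" "xyz p \<noteq> 0"
      have "cmod (fst p + snd p) \<le> 3 * cmod y"
        using q[OF p(1)] norm_triangle_ineq[of "fst p" "snd p"] x by linarith
      moreover have "cmod (snd p) \<le> 2 * cmod y"
        using q(3)[OF p(1)] norm_ge_zero[of y] by linarith
      ultimately have "(3 / 2 * cmod x * (2 * cmod y) * (3 * cmod y)) powr (- (4 * real m / 3)) \<le> xyz_weight m p"
        using q[OF p(1)] p(2) by (intro xyz_weight_ge) auto
      then show "(9 * (cmod y)\<^sup>2 * cmod x) powr (- (4 * real m / 3)) \<le> xyz_weight m p"
        by (simp add: power2_eq_square mult_ac)
    qed (use sub r s in auto)
    also have "\<dots> \<le> emeasure \<nu> (S n)"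
    proof -
      have "indicator (ball x r \<times> ball y s) q \<le> (indicator \<Omega> q * indicator (S n) q :: ennreal)" for q
      proof (cases "q \<in> ball x r \<times> ball y s")
        case True
        then have "q \<in> \<Omega>" "q \<in> S n" using sub by blast+
        with True show ?thesis by simp
      next
        case False
        then have "indicator (ball x r \<times> ball y s) q = (0 :: ennreal)"
          by (rule indicator_simps(2))
        then show ?thesis by (simp only: zero_le)
      qed
      then have "(\<integral>\<^sup>+q\<in>ball x r \<times> ball y s. ennreal (xyz_weight m q * (cmod (f q))\<^sup>2) \<partial>lborel)
          \<le> (\<integral>\<^sup>+q. ennreal (xyz_weight m q * (cmod (f q))\<^sup>2) * (indicator \<Omega> q * indicator (S n) q) \<partial>lborel)"
        by (intro nn_integral_mono mult_left_mono) auto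
      then show ?thesis
        using opS by (subst \<nu>) (auto simp: mult.assoc)
    qed
    finally show ?thesis .
  qed
  show ?thesis
  proof (rule tendstoI)
    fix e :: real assume e: "e > 0"
    have "\<forall>\<^sub>F n in sequentially. emeasure \<nu> (S n) < ennreal (C * e)"
      using order_tendstoD(2)[OF lim, of "ennreal (C * e)"] C e by (simp add: ennreal_zero_less_mult_iff)
    then obtain n where n: "emeasure \<nu> (S n) < ennreal (C * e)"
      by (meson eventually_sequentially order_refl)
    let ?d = "min (cmod y / 2) (1 / Suc n / 2)"
    have "dist ((cmod (f (x, y)))\<^sup>2 * cmod x powr (2 - 4 * real m / 3)) 0 < e"
      if "x \<noteq> 0" "dist x 0 < ?d" for x
    proof -
      have "ennreal (C * ((cmod (f (x, y)))\<^sup>2 * cmod x powr (2 - 4 * real m / 3))) < ennreal (C * e)"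
        using est[of x n] n that by (intro order_le_less_trans[OF _ n]) (auto simp: field_simps)
      then have "C * ((cmod (f (x, y)))\<^sup>2 * cmod x powr (2 - 4 * real m / 3)) < C * e"
        using C by (simp add: ennreal_less_iff)
      then show ?thesis using C by simp
    qed
    moreover have "?d > 0" using y by simp
    ultimately show "\<forall>\<^sub>F x in at 0. dist ((cmod (f (x, y)))\<^sup>2 * cmod x powr (2 - 4 * real m / 3)) 0 < e"
      unfolding eventually_at by blast
  qed
qed

subsection \<open>Orders of vanishing of the kernels\<close>

lemma holomorphic2_slice:
  assumes "holomorphic2_on f \<Omega>" "open \<Omega>" "ball 0 (2 * R) \<times> ball 0 (2 * R) \<subseteq> \<Omega>" "cmod y < R"
  shows "(\<lambda>x. f (x, y)) holomorphic_on ball 0 R"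
proof -
  have "(x, y) \<in> \<Omega>" if "x \<in> ball 0 R" for x
  proof -
    have "cmod x < R" using that by simp
    then have "cmod x < 2 * R" "cmod y < 2 * R"
      using assms(4) norm_ge_zero[of x] by linarith+
    then show ?thesis using assms(3) by auto
  qed
  then show ?thesis
    using holomorphic2_on_line[OF assms(1,2), of 0 1 y 0]
    by (auto intro: holomorphic_on_subset)
qed

text \<open>The basis is given and need not contain f; the kernel dominates every element of the
  space up to a constant. This is what makes products with powers of xyz usable as test
  functions.\<close>

lemma bergman_kernel_lower_bound:
  assumes \<Omega>: "open \<Omega>" and R: "0 < R" "ball 0 (2 * R) \<times> ball 0 (2 * R) \<subseteq> \<Omega>"
    and B: "orthonormal_basis \<Omega> phi_xyz m B" and f: "f \<in> bergman_space \<Omega> phi_xyz m"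
  shows "\<exists>\<alpha>>0. \<forall>x y. cmod x < R \<longrightarrow> cmod y < R \<longrightarrow>
      ennreal (\<alpha> * (cmod (f (x, y)))\<^sup>2) \<le> (\<Sum>\<^sub>\<infinity>s\<in>B. ennreal ((cmod (s (x, y)))\<^sup>2))"
proof -
  obtain A where "0 < A" and "\<forall>g\<in>bergman_space \<Omega> phi_xyz m. \<forall>x y. cmod x < R \<longrightarrow> cmod y < R
      \<longrightarrow> (cmod (g (x, y)))\<^sup>2 \<le> A * (bergman_norm \<Omega> phi_xyz m g)\<^sup>2"
    using bergman_point_evaluation[OF \<Omega> R, of m] by (elim exE conjE) (rule that)
  note A = this(1) this(2)[rule_format]
  \<comment> \<open>The summand 1 keeps N positive when f has norm 0.\<close>
  define N where "N = 4 * (bergman_norm \<Omega> phi_xyz m f)\<^sup>2 + 1"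
  have N: "N > 0" by (simp add: N_def add_nonneg_pos)
  show ?thesis
  proof (intro exI[of _ "1 / N"] conjI allI impI)
    fix x y assume xy: "cmod x < R" "cmod y < R"
    let ?K = "\<Sum>\<^sub>\<infinity>s\<in>B. ennreal ((cmod (s (x, y)))\<^sup>2)"
    have "ennreal ((cmod (f (x, y)))\<^sup>2) \<le> ennreal (4 * (bergman_norm \<Omega> phi_xyz m f)\<^sup>2) * ?K"
      by (rule bergman_kernel_ge[OF B \<Omega> less_imp_le[OF A(1)] A(2)[OF _ xy] f])
    also have "\<dots> \<le> ennreal N * ?K"
      by (intro mult_right_mono ennreal_leI) (auto simp: N_def)
    finally have "ennreal (1 / N) * ennreal ((cmod (f (x, y)))\<^sup>2) \<le> ennreal (1 / N) * (ennreal N * ?K)"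
      by (rule mult_left_mono) simp
    then show "ennreal (1 / N * (cmod (f (x, y)))\<^sup>2) \<le> ?K"
      using N by (simp add: ennreal_mult[symmetric] mult.assoc[symmetric])
  qed (use N in simp)
qed

text \<open>Evaluation bounds g on the slice by a constant times its norm, so the Schwarz lemma
  gives an estimate of order k + 1 that is uniform over the space. Such an estimate passes to the
  kernel, with the order doubled by squaring.\<close>

lemma bergman_kernel_order_le:
  assumes \<Omega>: "open \<Omega>" and R: "0 < R" "ball 0 (2 * R) \<times> ball 0 (2 * R) \<subseteq> \<Omega>"
    and y: "cmod y < R" and B: "orthonormal_basis \<Omega> phi_xyz m B"
    and order: "\<And>f. f \<in> bergman_space \<Omega> phi_xyz m \<Longrightarrow> ((\<lambda>x. f (x, y) / x ^ k) \<longlongrightarrow> 0) (at 0)"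
  shows "\<exists>\<beta>>0. \<forall>x. cmod x < R \<longrightarrow>
      (\<Sum>\<^sub>\<infinity>s\<in>B. ennreal ((cmod (s (x, y)))\<^sup>2)) \<le> ennreal (\<beta> * cmod x ^ (2 * Suc k))"
proof -
  let ?n = "bergman_norm \<Omega> phi_xyz m"
  obtain A where "0 < A" and "\<forall>g\<in>bergman_space \<Omega> phi_xyz m. \<forall>x y. cmod x < R \<longrightarrow> cmod y < R
      \<longrightarrow> (cmod (g (x, y)))\<^sup>2 \<le> A * (?n g)\<^sup>2"
    using bergman_point_evaluation[OF \<Omega> R, of m] by (elim exE conjE) (rule that)
  note A = this(1) this(2)[rule_format]
  show ?thesis
  proof (intro exI[of _ "A / R ^ (2 * Suc k)"] conjI allI impI)
    fix x assume x: "cmod x < R"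
    have "(cmod (g (x, y)))\<^sup>2 \<le> A / R ^ (2 * Suc k) * cmod x ^ (2 * Suc k) * (?n g)\<^sup>2"
      if g: "g \<in> bergman_space \<Omega> phi_xyz m" for g
    proof -
      have hol: "(\<lambda>x. g (x, y)) holomorphic_on ball 0 R"
        using g y by (intro holomorphic2_slice[OF _ \<Omega> R(2)]) (auto simp: bergman_space_def)
      have "cmod (g (w, y)) \<le> sqrt A * ?n g" if "w \<in> ball 0 R" for w
      proof -
        have "(cmod (g (w, y)))\<^sup>2 \<le> (sqrt A * ?n g)\<^sup>2"
          using A(2)[OF g _ y, of w] that A(1) by (simp add: power_mult_distrib)
        then show ?thesis
          by (rule power2_le_imp_le) (simp add: bergman_norm_nonneg less_imp_le[OF A(1)])
      qed
      from Schwarz_ball_order[OF hol this order[OF g], of x]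
      have "cmod (g (x, y)) \<le> sqrt A * ?n g * (cmod x / R) ^ Suc k"
        using x by simp
      then have "(cmod (g (x, y)))\<^sup>2 \<le> (sqrt A * ?n g * (cmod x / R) ^ Suc k)\<^sup>2"
        by (rule power_mono) simp
      also have "\<dots> = A * (?n g)\<^sup>2 * ((cmod x / R) ^ Suc k)\<^sup>2"
        unfolding power_mult_distrib using A(1) by simp
      also have "((cmod x / R) ^ Suc k)\<^sup>2 = cmod x ^ (2 * Suc k) / R ^ (2 * Suc k)"
        unfolding power_mult[symmetric] power_divide by (simp only: mult.commute)
      finally show ?thesis by (simp add: mult_ac)
    qed
    then show "(\<Sum>\<^sub>\<infinity>s\<in>B. ennreal ((cmod (s (x, y)))\<^sup>2))
        \<le> ennreal (A / R ^ (2 * Suc k) * cmod x ^ (2 * Suc k))"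
      by (rule bergman_kernel_le[OF B \<Omega>])
  qed (use A(1) R(1) in simp)
qed

lemma bergman_kernel_order_ge:
  assumes \<Omega>: "open \<Omega>" and R: "0 < R" "ball 0 (2 * R) \<times> ball 0 (2 * R) \<subseteq> \<Omega>"
    and y: "y \<noteq> 0" "cmod y < R" and B: "orthonormal_basis \<Omega> phi_xyz (m + 3 * j) B"
    and f: "f \<in> bergman_space \<Omega> phi_xyz m"
    and k: "0 < k" "0 < r" "\<And>x. cmod x < r \<Longrightarrow> k * cmod x ^ n \<le> cmod (f (x, y))"
  shows "\<exists>\<alpha>>0. \<exists>\<delta>>0. \<delta> \<le> R \<and> (\<forall>x. cmod x < \<delta> \<longrightarrow>
      ennreal (\<alpha> * cmod x ^ (4 * j + 2 * n)) \<le> (\<Sum>\<^sub>\<infinity>s\<in>B. ennreal ((cmod (s (x, y)))\<^sup>2)))"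
proof -
  obtain \<alpha> where "0 < \<alpha>" and "\<forall>x y. cmod x < R \<longrightarrow> cmod y < R \<longrightarrow>
      ennreal (\<alpha> * (cmod (xyz (x, y) ^ (2 * j) * f (x, y)))\<^sup>2) \<le> (\<Sum>\<^sub>\<infinity>s\<in>B. ennreal ((cmod (s (x, y)))\<^sup>2))"
    using bergman_kernel_lower_bound[OF \<Omega> R B bergman_space_shift[OF \<Omega> f]]
    by (elim exE conjE) (rule that)
  note \<alpha> = this(1) this(2)[rule_format]
  \<comment> \<open>For |x| < |y|/2 one has |y| |x + y| \<ge> |y|^2/2, so |xyz| is at least c|x|:
    near (0, y) only the factor x is small.\<close>
  define c where "c = (cmod y)\<^sup>2 / 2"
  have c: "c > 0" using y by (simp add: c_def)
  let ?\<delta> = "min R (min r (cmod y / 2))"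
  show ?thesis
  proof (rule exI[of _ "\<alpha> * (c ^ (4 * j) * k\<^sup>2)"], rule conjI, goal_cases)
    case 2
    show ?case
    proof (intro exI[of _ ?\<delta>] conjI allI impI)
      fix x assume x: "cmod x < ?\<delta>"
      have "cmod y / 2 \<le> cmod (x + y)"
        using x norm_triangle_ineq4[of "x + y" x] by simp
      then have "cmod x * (cmod y * (cmod y / 2)) \<le> cmod x * (cmod y * cmod (x + y))"
        by (intro mult_left_mono) auto
      then have z: "c * cmod x \<le> cmod (xyz (x, y))"
        by (simp add: xyz_def norm_mult c_def power2_eq_square mult_ac)
      have "c ^ (4 * j) * k\<^sup>2 * cmod x ^ (4 * j + 2 * n) = (c * cmod x) ^ (4 * j) * (k * cmod x ^ n)\<^sup>2"
        by (simp add: power_mult_distrib power_add power_mult[symmetric] mult_ac)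
      also have "\<dots> \<le> cmod (xyz (x, y)) ^ (4 * j) * (cmod (f (x, y)))\<^sup>2"
        using z k x c by (intro mult_mono power_mono) auto
      also have "\<dots> = (cmod (xyz (x, y) ^ (2 * j) * f (x, y)))\<^sup>2"
        by (simp add: norm_mult norm_power power_mult_distrib power_mult[symmetric] mult_ac)
      finally have "\<alpha> * (c ^ (4 * j) * k\<^sup>2) * cmod x ^ (4 * j + 2 * n)
          \<le> \<alpha> * (cmod (xyz (x, y) ^ (2 * j) * f (x, y)))\<^sup>2"
        using \<alpha>(1) by (simp add: mult.assoc)
      then show "ennreal (\<alpha> * (c ^ (4 * j) * k\<^sup>2) * cmod x ^ (4 * j + 2 * n))
          \<le> (\<Sum>\<^sub>\<infinity>s\<in>B. ennreal ((cmod (s (x, y)))\<^sup>2))"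
        using \<alpha>(2)[of x y] x y by (meson ennreal_leI min_less_iff_conj order_trans)
    qed (use k R y in auto)
  qed (use \<alpha> c k in simp)
qed

section \<open>Comparison of logarithmic growth\<close>

lemma elog_mono: "s \<le> t \<Longrightarrow> elog s \<le> elog t"
proof (cases "s = 0 \<or> t = \<infinity>")
  case False
  assume st: "s \<le> t"
  then obtain a b where ab: "s = ennreal a" "t = ennreal b" "0 \<le> a" "0 \<le> b"
    using False by (metis ennreal_enn2real enn2real_nonneg order_le_less_trans infinity_ennreal_def less_top)
  then have "0 < a" "a \<le> b" using False st by (auto simp: ennreal_le_iff less_le)
  then show ?thesis using ab by (simp add: elog_ennreal)
qed (auto simp: elog_def)

text \<open>With t = exp(-s) the lower bound for the left side and the upper bound for the right
  side become affine in s, with slopes -a/(2n) and -b/(2m). As s tends to infinity the slopes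
  decide, whatever the constants are.\<close>

lemma order_comparison:
  assumes mn: "0 < m" "0 < n" and ab: "0 < \<alpha>" "0 < \<beta>" "0 < \<delta>"
    and le: "\<And>t. 0 < t \<Longrightarrow> t < \<delta> \<Longrightarrow>
      ereal (1 / (2 * real n)) * elog (K t) + ereal c \<le> ereal (1 / (2 * real m)) * elog (L t) + ereal d"
    and K: "\<And>t. 0 < t \<Longrightarrow> t < \<delta> \<Longrightarrow> ennreal (\<alpha> * t ^ a) \<le> K t"
    and L: "\<And>t. 0 < t \<Longrightarrow> t < \<delta> \<Longrightarrow> L t \<le> ennreal (\<beta> * t ^ b)"
  shows "n * b \<le> m * a"
proof (rule ccontr)
  assume "\<not> n * b \<le> m * a"
  then have "real (m * a) < real (n * b)" by linarith
  then have gap: "real b / (2 * m) - real a / (2 * n) > 0"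
    using mn by (simp add: field_simps)
  let ?g = "real b / (2 * m) - real a / (2 * n)"
  define D where "D = ln \<beta> / (2 * m) + d - ln \<alpha> / (2 * n) - c"
  have bound: "?g * s \<le> D" if s: "exp (- s) < \<delta>" for s
  proof -
    let ?t = "exp (- s)"
    have lns: "ln (\<alpha> * ?t ^ a) = ln \<alpha> - a * s" "ln (\<beta> * ?t ^ b) = ln \<beta> - b * s"
      using ab by (simp_all add: ln_mult ln_realpow)
    have "ereal ((ln \<alpha> - a * s) / (2 * n) + c) = ereal (1 / (2 * real n)) * elog (ennreal (\<alpha> * ?t ^ a)) + ereal c"
      using ab by (simp add: elog_ennreal lns)
    also have "\<dots> \<le> ereal (1 / (2 * real n)) * elog (K ?t) + ereal c"
      using K[of ?t] s by (intro add_right_mono ereal_mult_left_mono elog_mono) auto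
    also have "\<dots> \<le> ereal (1 / (2 * real m)) * elog (L ?t) + ereal d"
      using le s by simp
    also have "\<dots> \<le> ereal (1 / (2 * real m)) * elog (ennreal (\<beta> * ?t ^ b)) + ereal d"
      using L[of ?t] s by (intro add_right_mono ereal_mult_left_mono elog_mono) auto
    also have "\<dots> = ereal ((ln \<beta> - b * s) / (2 * m) + d)"
      using ab by (simp add: elog_ennreal lns)
    finally have "(ln \<alpha> - a * s) / (2 * n) + c \<le> (ln \<beta> - b * s) / (2 * m) + d" by simp
    then show ?thesis by (simp add: D_def diff_divide_distrib left_diff_distrib)
  qed
  \<comment> \<open>The first entry gives exp(-s) < \<delta>, so that the bound applies; the second
    makes \<open>?g * s\<close> at least D + \<open>?g\<close>, which exceeds D.\<close>
  define s where "s = max (1 - ln \<delta>) (D / ?g + 1)"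
  have "exp (- s) < exp (ln \<delta>)" unfolding s_def by (intro exp_less_mono) linarith
  then have "?g * s \<le> D" using ab by (intro bound) simp
  moreover have "?g * s \<ge> ?g * (D / ?g + 1)"
    using gap by (intro mult_left_mono) (auto simp: s_def)
  moreover have "?g * (D / ?g + 1) = D + ?g"
    using gap by (simp add: distrib_left)
  ultimately show False using gap by linarith
qed

lemma decreasing_sequence_on_le:
  assumes "decreasing_sequence_on \<Omega> \<psi>" "1 \<le> m" "m \<le> n" "p \<in> \<Omega>"
  shows "\<psi> n p \<le> \<psi> m p"
  using assms(3)
proof (induction n rule: dec_induct)
  case (step n)
  have "\<psi> (Suc n) p \<le> \<psi> n p"
    using assms step unfolding decreasing_sequence_on_def by simp
  with step show ?case by simp
qed simp

lemma demailly_approx_eq_MInfty_iff: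
  assumes "0 < m"
  shows "demailly_approx m B p = -\<infinity> \<longleftrightarrow> (\<Sum>\<^sub>\<infinity>s\<in>B. ennreal ((cmod (s p))\<^sup>2)) = 0"
  using assms by (auto simp: demailly_approx_def elog_def)

lemma infsum_cmod_square_nonzero:
  assumes "(\<Sum>\<^sub>\<infinity>s\<in>B. ennreal ((cmod (s p))\<^sup>2)) \<noteq> 0"
  obtains s where "s \<in> B" "s p \<noteq> 0"
proof -
  have "\<exists>s\<in>B. s p \<noteq> 0"
  proof (rule ccontr)
    assume "\<not> ?thesis"
    then have "(\<Sum>\<^sub>\<infinity>s\<in>B. ennreal ((cmod (s p))\<^sup>2)) = 0" by (intro infsum_0) auto
    with assms show False by simp
  qed
  then show ?thesis using that by blast
qed

text \<open>For m = 3 the exponent 2 - 4m/3 is -2, and the square root of the expression is |f/x|.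
  The limit 0 excludes the borderline order 1, which mere boundedness would allow; with order 1 the
  final comparison would give no contradiction.\<close>

lemma bergman_vanishing_order_3:
  assumes \<Omega>: "open \<Omega>" and f: "f \<in> bergman_space \<Omega> phi_xyz 3"
    and R: "0 < R" "ball 0 (2 * R) \<times> ball 0 (2 * R) \<subseteq> \<Omega>"
    and y: "y \<noteq> 0" "cmod y < R"
  shows "((\<lambda>x. f (x, y) / x ^ 1) \<longlongrightarrow> 0) (at 0)"
proof -
  have "((\<lambda>x. sqrt ((cmod (f (x, y)))\<^sup>2 * cmod x powr (2 - 4 * real 3 / 3))) \<longlongrightarrow> sqrt 0) (at 0)"
    by (intro tendsto_real_sqrt bergman_vanishing_order[OF \<Omega> f R y])
  moreover have "\<forall>\<^sub>F x in at 0. sqrt ((cmod (f (x, y)))\<^sup>2 * cmod x powr (2 - 4 * real 3 / 3))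
      = cmod (f (x, y) / x ^ 1)"
  proof -
    have "sqrt ((cmod (f (x, y)))\<^sup>2 * cmod x powr (2 - 4 * real 3 / 3)) = cmod (f (x, y) / x ^ 1)"
      if "x \<noteq> 0" for x
      using that by (simp add: powr_minus_divide norm_divide real_sqrt_mult real_sqrt_divide)
    then show ?thesis by (auto simp: eventually_at intro!: exI[of _ 1])
  qed
  ultimately have "((\<lambda>x. cmod (f (x, y) / x ^ 1)) \<longlongrightarrow> 0) (at 0)"
    by (simp add: filterlim_cong)
  then show ?thesis by (rule tendsto_norm_zero_cancel)
qed

theorem theorem2p1:
  fixes \<Omega> :: "(complex \<times> complex) set"
    and \<phi> :: "complex \<times> complex \<Rightarrow> ereal"
    and \<psi> :: "nat \<Rightarrow> complex \<times> complex \<Rightarrow> ereal"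
  assumes "stein_open \<Omega>" and "connected \<Omega>" and "(0, 0) \<in> \<Omega>"
    and "\<phi> = phi_D (2/3) (2/3) (2/3)"
    and "demailly_sequence \<Omega> \<phi> \<psi>"
    and nonzero: "\<exists>m\<ge>1. \<exists>p\<in>\<Omega>. \<psi> m p \<noteq> -\<infinity>"
  shows "\<not> (\<exists>C :: nat \<Rightarrow> real. decreasing_sequence_on \<Omega> (\<lambda>m p. \<psi> m p + ereal (C m)))"
proof
  assume "\<exists>C :: nat \<Rightarrow> real. decreasing_sequence_on \<Omega> (\<lambda>m p. \<psi> m p + ereal (C m))"
  then obtain C :: "nat \<Rightarrow> real" where C: "decreasing_sequence_on \<Omega> (\<lambda>m p. \<psi> m p + ereal (C m))" ..
  have \<Omega>: "open \<Omega>" using assms(1) by (simp add: stein_open_def)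
  \<comment> \<open>Radius 2R leaves room for polydiscs of radius R around all points of the
    polydisc of radius R.\<close>
  obtain R where R: "0 < R" "ball 0 (2 * R) \<times> ball 0 (2 * R) \<subseteq> \<Omega>"
  proof -
    obtain U V where UV: "open U" "open V" "(0, 0) \<in> U \<times> V" "U \<times> V \<subseteq> \<Omega>"
      using \<Omega> assms(3) by (rule open_prod_elim)
    have "0 \<in> U" "0 \<in> V" using UV(3) by auto
    then obtain r s where rs: "0 < r" "ball 0 r \<subseteq> U" "0 < s" "ball 0 s \<subseteq> V"
      using UV(1,2) by (metis openE)
    let ?R = "min r s / 2"
    have "ball 0 (2 * ?R) \<times> ball 0 (2 * ?R) \<subseteq> ball 0 r \<times> ball (0::complex) s"
      by (intro Sigma_mono subset_ball) auto
    also have "\<dots> \<subseteq> U \<times> V" using rs by (intro Sigma_mono)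
    also note UV(4)
    finally show ?thesis using rs by (intro that[of ?R]) auto
  qed
  have small: "(x, y) \<in> \<Omega>" if "cmod x < R" "cmod y < R" for x y
  proof -
    have "x \<in> ball 0 (2 * R)" "y \<in> ball 0 (2 * R)" using that R(1) by auto
    then show ?thesis using R(2) by blast
  qed
  have "\<forall>m. \<exists>B. 1 \<le> m \<longrightarrow> orthonormal_basis \<Omega> phi_xyz m B \<and> (\<forall>p\<in>\<Omega>. \<psi> m p = demailly_approx m B p)"
    using assms(5) unfolding demailly_sequence_def assms(4) by blast
  then obtain B where B: "\<And>m. 1 \<le> m \<Longrightarrow> orthonormal_basis \<Omega> phi_xyz m (B m)"
    and \<psi>: "\<And>m p. 1 \<le> m \<Longrightarrow> p \<in> \<Omega> \<Longrightarrow> \<psi> m p = demailly_approx m (B m) p"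
    by metis
  define K where "K = (\<lambda>m p. \<Sum>\<^sub>\<infinity>s\<in>B m. ennreal ((cmod (s p))\<^sup>2))"
  have BH: "s \<in> bergman_space \<Omega> phi_xyz m" if "1 \<le> m" "s \<in> B m" for m s
  proof -
    have "B m \<subseteq> bergman_space \<Omega> phi_xyz m"
      using B[OF that(1)] unfolding orthonormal_basis_def by (elim conjE)
    with that(2) show ?thesis by blast
  qed
  have dec: "\<psi> n p + ereal (C n) \<le> \<psi> m p + ereal (C m)" if "1 \<le> m" "m \<le> n" "p \<in> \<Omega>" for m n p
    using decreasing_sequence_on_le[OF C that] .

  \<comment> \<open>The identity theorem moves nonvanishing from an arbitrary point of \<Omega> into
    the small polydisc. There K_m is positive at p, so \<psi>_m(p) is not -\<infinity>, and by the
    assumed decrease neither is \<psi>_1(p).\<close>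
  obtain f\<^sub>1 p\<^sub>1 where f\<^sub>1: "f\<^sub>1 \<in> bergman_space \<Omega> phi_xyz 1" "f\<^sub>1 p\<^sub>1 \<noteq> 0" "p\<^sub>1 \<in> ball 0 R \<times> ball 0 R"
  proof -
    obtain m p\<^sub>0 where m: "1 \<le> m" "p\<^sub>0 \<in> \<Omega>" "\<psi> m p\<^sub>0 \<noteq> -\<infinity>" using nonzero by blast
    have "K m p\<^sub>0 \<noteq> 0"
      using m(3) demailly_approx_eq_MInfty_iff[of m "B m" p\<^sub>0] m(1)
      by (simp add: \<psi>[OF m(1,2)] K_def)
    then obtain s where s: "s \<in> B m" "s p\<^sub>0 \<noteq> 0"
      unfolding K_def by (rule infsum_cmod_square_nonzero)
    have hol: "holomorphic2_on s \<Omega>" using BH[OF m(1) s(1)] by (simp add: bergman_space_def)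
    let ?P = "ball (0::complex) R \<times> ball (0::complex) R"
    have near: "\<forall>\<^sub>F q in nhds (0, 0). q \<in> ?P"
      using R(1) by (intro eventually_nhds_in_open open_Times) auto
    have "\<exists>p\<in>?P. s p \<noteq> 0"
    proof (rule ccontr)
      assume "\<not> (\<exists>p\<in>?P. s p \<noteq> 0)"
      then have "\<forall>\<^sub>F q in nhds (0, 0). s q = 0"
        by (intro eventually_mono[OF near]) blast
      from holomorphic2_identity[OF hol \<Omega> assms(2,3) this m(2)] s(2) show False by simp
    qed
    then obtain p where p: "p \<in> ?P" "s p \<noteq> 0"
      by (elim bexE) (rule that)
    obtain x y where xy: "p = (x, y)" "cmod x < R" "cmod y < R"
      using p(1) by (cases p) auto
    obtain \<alpha> where \<alpha>: "0 < \<alpha>" and "\<forall>x y. cmod x < R \<longrightarrow> cmod y < R \<longrightarrow> ennreal (\<alpha> * (cmod (s (x, y)))\<^sup>2) \<le> K m (x, y)"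
      using bergman_kernel_lower_bound[OF \<Omega> R B[OF m(1)] BH[OF m(1) s(1)]]
      by (elim exE conjE) (rule that, simp_all add: K_def)
    then have "ennreal (\<alpha> * (cmod (s (x, y)))\<^sup>2) \<le> K m (x, y)" using xy by simp
    then have "K m p \<noteq> 0"
      using p(2) \<alpha> by (auto simp: xy ennreal_eq_0_iff mult_le_0_iff)
    then have "\<psi> m p \<noteq> -\<infinity>"
      using m(1) small[OF xy(2,3)] \<psi>[OF m(1), of p] demailly_approx_eq_MInfty_iff[of m "B m" p]
      by (simp add: xy K_def)
    then have "\<psi> 1 p \<noteq> -\<infinity>"
      using dec[of 1 m p] m(1) small[OF xy(2,3)] by (auto simp: xy)
    then have "K 1 p \<noteq> 0"
      using small[OF xy(2,3)] \<psi>[of 1 p] demailly_approx_eq_MInfty_iff[of 1 "B 1" p]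
      by (simp add: xy K_def)
    then obtain f where "f \<in> B 1" "f p \<noteq> 0"
      unfolding K_def by (rule infsum_cmod_square_nonzero)
    then show ?thesis using that BH p(1) by blast
  qed

  \<comment> \<open>The set where \<open>f\<^sub>1\<close> is nonzero is open and nonempty, so it
    cannot lie in the null set xyz = 0. The resulting y puts (0, y) off the other two lines, while
    the slice of \<open>f\<^sub>1\<close> at height y is not identically zero.\<close>
  obtain x\<^sub>0 y where y: "f\<^sub>1 (x\<^sub>0, y) \<noteq> 0" "x\<^sub>0 \<noteq> 0" "y \<noteq> 0" "cmod x\<^sub>0 < R" "cmod y < R"
  proof -
    let ?P = "ball (0::complex) R \<times> ball (0::complex) R"
    define U where "U = {q \<in> ?P. f\<^sub>1 q \<noteq> 0}"
    have "continuous_on ?P f\<^sub>1"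
      using f\<^sub>1(1) small by (intro continuous_on_subset[OF holomorphic2_imp_continuous_on[of f\<^sub>1 \<Omega>]])
        (auto simp: bergman_space_def)
    then have "open (?P \<inter> f\<^sub>1 -` (- {0}))"
      by (intro continuous_open_preimage) (auto intro: open_Times)
    moreover have "U = ?P \<inter> f\<^sub>1 -` (- {0})"
      unfolding U_def by auto
    ultimately have U: "open U" by (simp only:)
    have "\<exists>q\<in>U. xyz q \<noteq> 0"
    proof (rule ccontr)
      assume "\<not> ?thesis"
      then have "AE q in lborel. q \<in> - U"
        by (intro eventually_mono[OF AE_xyz_nonzero]) auto
      then have "AE q in lebesgue. q \<in> - U"
        by (rule AE_completion)
      then have "p\<^sub>1 \<in> - U"
        using U by (intro mem_closed_if_AE_lebesgue) auto
      then show False using f\<^sub>1 by (simp add: U_def)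
    qed
    then show ?thesis using that by (auto simp: U_def xyz_def)
  qed

  have slice: "(\<lambda>x. f (x, y)) holomorphic_on ball 0 R" if "f \<in> bergman_space \<Omega> phi_xyz m" for f m
    using that y(5) by (intro holomorphic2_slice[OF _ \<Omega> R(2)]) (auto simp: bergman_space_def)
  \<comment> \<open>Evaluated at positive real x only; the conclusion says b/m \<le> a/n for the
    orders of the two kernels.\<close>
  have compare: "n * b \<le> m * a"
    if mn: "1 \<le> m" "m \<le> n" and ab: "0 < \<alpha>" "0 < \<beta>" "0 < \<delta>" "\<delta> \<le> R"
      and lower: "\<And>x. cmod x < \<delta> \<Longrightarrow> ennreal (\<alpha> * cmod x ^ a) \<le> K n (x, y)"
      and upper: "\<And>x. cmod x < R \<Longrightarrow> K m (x, y) \<le> ennreal (\<beta> * cmod x ^ b)"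
    for m n a b \<alpha> \<beta> \<delta>
  proof (rule order_comparison[OF _ _ ab(1-3), of m n "\<lambda>t. K n (of_real t, y)" "C n" "\<lambda>t. K m (of_real t, y)" "C m"])
    fix t :: real assume t: "0 < t" "t < \<delta>"
    have "(of_real t, y) \<in> \<Omega>" using t ab(4) y(5) by (intro small) auto
    then show "ereal (1 / (2 * real n)) * elog (K n (of_real t, y)) + ereal (C n)
        \<le> ereal (1 / (2 * real m)) * elog (K m (of_real t, y)) + ereal (C m)"
      using dec[of m n "(of_real t, y)"] mn by (simp add: \<psi> demailly_approx_def K_def)
    show "ennreal (\<alpha> * t ^ a) \<le> K n (of_real t, y)"
      using lower[of "of_real t"] t by simp
    show "K m (of_real t, y) \<le> ennreal (\<beta> * t ^ b)"
      using upper[of "of_real t"] t ab(4) by simp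
  qed (use mn in auto)

  have "\<exists>f\<in>bergman_space \<Omega> phi_xyz 1. f (0, y) \<noteq> 0"
  proof (rule ccontr)
    assume "\<not> ?thesis"
    then have zero: "g (0, y) = 0" if "g \<in> bergman_space \<Omega> phi_xyz 1" for g
      using that by blast
    have order_0: "((\<lambda>x. g (x, y) / x ^ 0) \<longlongrightarrow> 0) (at 0)" if g: "g \<in> bergman_space \<Omega> phi_xyz 1" for g
    proof -
      have "isCont (\<lambda>x. g (x, y)) 0"
        using slice[OF g] R(1)
        by (metis centre_in_ball continuous_on_eq_continuous_at holomorphic_on_imp_continuous_on open_ball)
      then show ?thesis using zero[OF g] by (simp add: isCont_def)
    qed
    have "\<exists>\<beta>>0. \<forall>x. cmod x < R \<longrightarrow> K 1 (x, y) \<le> ennreal (\<beta> * cmod x ^ (2 * Suc 0))"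
      unfolding K_def by (rule bergman_kernel_order_le[OF \<Omega> R y(5) B[OF order_refl]]) (rule order_0)
    then obtain \<beta> where \<beta>: "0 < \<beta>" "\<forall>x. cmod x < R \<longrightarrow> K 1 (x, y) \<le> ennreal (\<beta> * cmod x ^ (2 * Suc 0))"
      by (elim exE conjE) (rule that)
    \<comment> \<open>The factor x makes \<open>?h\<close> vanish at 0, so a lower bound for its
      increment bounds \<open>?h\<close> itself. For |x| < 1 dropping the factor preserves the
      bound.\<close>
    let ?h = "\<lambda>x. x * f\<^sub>1 (x, y)"
    have hol: "?h holomorphic_on ball 0 R"
      using slice[OF f\<^sub>1(1)] by (intro holomorphic_intros)
    have ne: "?h x\<^sub>0 \<noteq> ?h 0" using y by simp
    have mem: "0 \<in> ball 0 R" "x\<^sub>0 \<in> ball 0 R" using R y by auto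
    obtain k n r where k: "0 < k" "0 < r" "ball 0 r \<subseteq> ball (0::complex) R"
      "\<And>w. w \<in> ball 0 r \<Longrightarrow> k * cmod (w - 0) ^ n \<le> cmod (?h w - ?h 0)"
      by (rule holomorphic_lower_bound_difference[OF hol open_ball connected_ball mem ne]) blast
    have k': "k * cmod x ^ n \<le> cmod (f\<^sub>1 (x, y))" if "cmod x < min r 1" for x
    proof -
      have "k * cmod x ^ n \<le> cmod x * cmod (f\<^sub>1 (x, y))"
        using k(4)[of x] that by (simp add: norm_mult)
      also have "\<dots> \<le> 1 * cmod (f\<^sub>1 (x, y))"
        using that by (intro mult_right_mono) auto
      finally show ?thesis by simp
    qed
    have r1: "0 < min r 1" using k(2) by simp
    \<comment> \<open>The power j of (xyz)^2 is taken equal to n, the least choice that works: the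
      comparison then reads 2(1 + 3n) \<le> 6n, which is false for every n.\<close>
    have "\<exists>\<alpha>>0. \<exists>\<delta>>0. \<delta> \<le> R \<and> (\<forall>x. cmod x < \<delta> \<longrightarrow>
        ennreal (\<alpha> * cmod x ^ (4 * n + 2 * n)) \<le> K (1 + 3 * n) (x, y))"
      unfolding K_def
      by (rule bergman_kernel_order_ge[OF \<Omega> R y(3,5) B f\<^sub>1(1) k(1) r1]) (simp, rule k')
    then obtain \<alpha> \<delta> where \<alpha>: "0 < \<alpha>" "0 < \<delta>" "\<delta> \<le> R"
      "\<forall>x. cmod x < \<delta> \<longrightarrow> ennreal (\<alpha> * cmod x ^ (4 * n + 2 * n)) \<le> K (1 + 3 * n) (x, y)"
      by (elim exE conjE) (rule that)
    from compare[OF _ _ \<alpha>(1) \<beta>(1) \<alpha>(2,3) \<alpha>(4)[rule_format] \<beta>(2)[rule_format]]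
    have "(1 + 3 * n) * (2 * Suc 0) \<le> 1 * (4 * n + 2 * n)" by simp
    then show False by simp
  qed
  then obtain f where f: "f \<in> bergman_space \<Omega> phi_xyz 1" "f (0, y) \<noteq> 0"
    by (elim bexE) (rule that)

  have "isCont (\<lambda>x. f (x, y)) 0"
    using slice[OF f(1)] R(1)
    by (metis centre_in_ball continuous_on_eq_continuous_at holomorphic_on_imp_continuous_on open_ball)
  then have "((\<lambda>x. cmod (f (x, y))) \<longlongrightarrow> cmod (f (0, y))) (nhds 0)"
    using tendsto_at_iff_tendsto_nhds[of "\<lambda>x. f (x, y)" 0] by (intro tendsto_norm) (simp add: isCont_def)
  then have "\<forall>\<^sub>F x in nhds 0. cmod (f (0, y)) / 2 < cmod (f (x, y))"
    using f(2) by (intro order_tendstoD) auto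
  then obtain r where r: "0 < r" "\<And>x. cmod x < r \<Longrightarrow> cmod (f (0, y)) / 2 < cmod (f (x, y))"
    by (auto simp: eventually_nhds_metric)
  then have r': "cmod (f (0, y)) / 2 * cmod x ^ 0 \<le> cmod (f (x, y))" if "cmod x < r" for x
    using that by (simp add: less_imp_le)
  have f0: "0 < cmod (f (0, y)) / 2" using f(2) by simp
  have "\<exists>\<alpha>>0. \<exists>\<delta>>0. \<delta> \<le> R \<and> (\<forall>x. cmod x < \<delta> \<longrightarrow>
      ennreal (\<alpha> * cmod x ^ (4 * 1 + 2 * 0)) \<le> K (1 + 3 * 1) (x, y))"
    unfolding K_def
    by (rule bergman_kernel_order_ge[OF \<Omega> R y(3,5) B f(1) f0 r(1)]) (simp, rule r')
  then obtain \<alpha> \<delta> where \<alpha>: "0 < \<alpha>" "0 < \<delta>" "\<delta> \<le> R"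
    "\<forall>x. cmod x < \<delta> \<longrightarrow> ennreal (\<alpha> * cmod x ^ (4 * 1 + 2 * 0)) \<le> K (1 + 3 * 1) (x, y)"
    by (elim exE conjE) (rule that)
  have "\<exists>\<beta>>0. \<forall>x. cmod x < R \<longrightarrow> K 3 (x, y) \<le> ennreal (\<beta> * cmod x ^ (2 * Suc 1))"
    unfolding K_def
    by (rule bergman_kernel_order_le[OF \<Omega> R y(5) B]) (simp, rule bergman_vanishing_order_3[OF \<Omega> _ R y(3,5)])
  then obtain \<beta> where \<beta>: "0 < \<beta>" "\<forall>x. cmod x < R \<longrightarrow> K 3 (x, y) \<le> ennreal (\<beta> * cmod x ^ (2 * Suc 1))"
    by (elim exE conjE) (rule that)
  \<comment> \<open>Both kernels are compared with |x|^4, from above for m = 3 and from below for m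
    = 4; only the normalisations 1/(2m) differ, and the inequality is 16 \<le> 12.\<close>
  have "(1 + 3 * 1) * (2 * Suc 1) \<le> 3 * (4 * 1 + 2 * 0 :: nat)"
    by (rule compare[OF _ _ \<alpha>(1) \<beta>(1) \<alpha>(2,3) \<alpha>(4)[rule_format] \<beta>(2)[rule_format]]) auto
  then show False by simp
qed

end
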